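(* Let $N>2$ be an integer and let $q\in\,]0,1[$ be such that $q+q^{-1}=N$. For all $a,c\in\mathbb{N}$ there exist two constants $\lambda_{a,c}>0$ and $D_{a,c}>0$, depending only on $N$, $a$ and $c$, such that for every $b\in\mathbb{N}$ the operator $$x_{a,b,c}=(\mathrm{id}_a\otimes \operatorname{tr}_b\otimes \mathrm{id}_c)(P_{a+b+c}) : H_a\otimes H_c\to H_a\otimes H_c$$ satisfies (in operator norm) $$\|x_{a,b,c}-\lambda_{a,c}(\mathrm{id}_a\otimes\mathrm{id}_c)\|\leqslant D_{a,c}\,q^b.$$ In particular $x_{a,b,c}\to\lambda_{a,c}(\mathrm{id}_a\otimes \mathrm{id}_c)$ as $b\to\infty$.
   Context: Let $H_1=\mathbb{C}^N$ with canonical orthonormal basis $(e_i)_{1\leqslant i\leqslant N}$, and let $t_1=\sum_{i=1}^N e_i\otimes e_i\in H_1\otimes H_1$, also viewed as a map $t_1:\mathbb{C}\to H_1\otimes H_1$. Let $O_N^+$ be the free orthogonal quantum group: $C(O_N^+)$ is the universal unital C*-algebra generated by $N^2$ self-adjoint elements $u_{ij}$ such that $u=(u_{ij})$ is unitary, with coproduct $\Delta(u_{ij})=\sum_k u_{ik}\otimes u_{kj}$. Its irreducible representations (Banica) are $(u^n)_{n\in\mathbb{N}}$, with $u^0$ trivial, $u^1=u$ and $u^1\otimes u^n\simeq u^{n+1}\oplus u^{n-1}$ for $n\geqslant 1$. For $n\in\mathbb{N}$, $H_n\subset H_1^{\otimes n}$ is the unique subspace on which $u^{\otimes n}$ restricts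 to a representation equivalent to $u^n$ ($H_0=\mathbb{C}$); equivalently, $H_n$ is the set of vectors of $H_1^{\otimes n}$ annihilated by all maps $\mathrm{id}_1^{\otimes i}\otimes t_1^*\otimes \mathrm{id}_1^{\otimes (n-i-2)}$, $0\leqslant i\leqslant n-2$. $P_n$ is the orthogonal projection of $H_1^{\otimes n}$ onto $H_n$ (Jones-Wenzl projection), and $\mathrm{id}_n$ is the identity of $H_n$. One has $d_n=\dim H_n=\frac{q^{n+1}-q^{-n-1}}{q-q^{-1}}$. Since $P_{a+b+c}=P_{a+b+c}(P_a\otimes P_b\otimes P_c)=(P_a\otimes P_b\otimes P_c)P_{a+b+c}$, the projection $P_{a+b+c}$ is viewed as an element of $\mathcal{B}(H_a\otimes H_b\otimes H_c)$. $\operatorname{tr}_b=d_b^{-1}\operatorname{Tr}$ is the normalized trace on $\mathcal{B}(H_b)$, and in $(\mathrm{id}_a\otimes\operatorname{tr}_b\otimes\mathrm{id}_c)$ the symbols $\mathrm{id}_a,\mathrm{id}_c$ denote the identity maps of $\mathcal{B}(H_a)$, $\mathcal{B}(H_c)$ (partial trace over the middle factor). *)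

theory Defs
  imports Complex_Main "HOL-Analysis.L2_Norm"
    "Jordan_Normal_Form.Schur_Decomposition" "Jordan_Normal_Form.VS_Connect"
begin

text \<open>
  The tensor power of n copies of complex N-space is \<^term>\<open>carrier_vec (N ^ n) :: complex vec set\<close>:
  a simple tensor of canonical basis vectors is the canonical basis vector whose index has the
  given indices as its base-N digits, the leftmost factor being the most significant one.
  Linear maps are matrices, and tensor products are Kronecker products.
\<close>

definition kron_vec :: "complex vec \<Rightarrow> complex vec \<Rightarrow> complex vec" where
  "kron_vec v w = vec (dim_vec v * dim_vec w)
     (\<lambda>i. v $ (i div dim_vec w) * w $ (i mod dim_vec w))"

definition kron_mat :: "complex mat \<Rightarrow> complex mat \<Rightarrow> complex mat" where
  "kron_mat A B = mat (dim_row A * dim_row B) (dim_col A * dim_col B)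
     (\<lambda>(i, j). A $$ (i div dim_row B, j div dim_col B) * B $$ (i mod dim_row B, j mod dim_col B))"

definition orth_proj :: "nat \<Rightarrow> complex vec set \<Rightarrow> complex mat" where
  "orth_proj n W = (THE P. P \<in> carrier_mat n n \<and>
     (\<forall>v \<in> carrier_vec n. P *\<^sub>v v \<in> W \<and> (\<forall>w \<in> W. (v - P *\<^sub>v v) \<bullet>c w = 0)))"

definition subspace_dim :: "nat \<Rightarrow> complex vec set \<Rightarrow> nat" where
  "subspace_dim n W = vectorspace.dim class_ring ((module_vec TYPE(complex) n)\<lparr>carrier := W\<rparr>)"

text \<open>The tensor product of a subspace V of complex m-space with a subspace W of complex n-space,
  inside complex (m * n)-space.\<close>

definition tensor_subspace ::
    "nat \<Rightarrow> nat \<Rightarrow> complex vec set \<Rightarrow> complex vec set \<Rightarrow> complex vec set" where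
  "tensor_subspace m n V W =
     LinearCombinations.module.span class_ring (module_vec TYPE(complex) (m * n))
       {kron_vec v w | v w. v \<in> V \<and> w \<in> W}"

definition euclid_norm :: "complex vec \<Rightarrow> real" where
  "euclid_norm v = L2_set (\<lambda>i. cmod (v $ i)) {..<dim_vec v}"

definition op_norm_on :: "complex vec set \<Rightarrow> complex mat \<Rightarrow> real" where
  "op_norm_on W A = Sup {euclid_norm (A *\<^sub>v v) | v. v \<in> W \<and> euclid_norm v \<le> 1}"

text \<open>The unnormalized partial trace over the middle factor of a tensor product of full spaces of
  dimensions m, p and r.\<close>

definition ptrace_mid :: "nat \<Rightarrow> nat \<Rightarrow> nat \<Rightarrow> complex mat \<Rightarrow> complex mat" where
  "ptrace_mid m p r X = mat (m * r) (m * r)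
     (\<lambda>(s, t). \<Sum>k<p. X $$ (((s div r) * p + k) * r + s mod r, ((t div r) * p + k) * r + t mod r))"

definition t1 :: "nat \<Rightarrow> complex mat" where
  "t1 N = mat (N * N) 1 (\<lambda>(k, _). \<Sum>i<N. kron_vec (unit_vec N i) (unit_vec N i) $ k)"

text \<open>For the free orthogonal quantum group of size N, this is the subspace of the n-th tensor power
  carrying the n-th irreducible representation, described as the set of vectors annihilated by all
  contractions of two neighbouring factors; JW is the Jones-Wenzl projection.\<close>

definition H :: "nat \<Rightarrow> nat \<Rightarrow> complex vec set" where
  "H N n = {v \<in> carrier_vec (N ^ n). \<forall>i. i + 2 \<le> n \<longrightarrow>
     kron_mat (kron_mat (1\<^sub>m (N ^ i)) (mat_adjoint (t1 N))) (1\<^sub>m (N ^ (n - i - 2))) *\<^sub>v v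
       = 0\<^sub>v (N ^ (n - 2))}"

definition JW :: "nat \<Rightarrow> nat \<Rightarrow> complex mat" where
  "JW N n = orth_proj (N ^ n) (H N n)"

definition HH :: "nat \<Rightarrow> nat \<Rightarrow> nat \<Rightarrow> complex vec set" where
  "HH N a c = tensor_subspace (N ^ a) (N ^ c) (H N a) (H N c)"

text \<open>
  An operator on \<open>H\<^sub>a \<otimes> H\<^sub>b \<otimes> H\<^sub>c\<close> is represented by its extension by zero to the full
  tensor power, i.e. by a matrix in the corner cut out by \<open>P\<^sub>a \<otimes> P\<^sub>b \<otimes> P\<^sub>c\<close>.
  On this corner the partial trace over \<open>H\<^sub>b\<close> is the one over the full middle factor; the
  normalization is by the dimension of \<open>H\<^sub>b\<close>.
\<close>

definition JW3 :: "nat \<Rightarrow> nat \<Rightarrow> nat \<Rightarrow> nat \<Rightarrow> complex mat" where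
  "JW3 N a b c =
     (let E = kron_mat (kron_mat (JW N a) (JW N b)) (JW N c) in E * JW N (a + b + c) * E)"

definition x_op :: "nat \<Rightarrow> nat \<Rightarrow> nat \<Rightarrow> nat \<Rightarrow> complex mat" where
  "x_op N a b c = (1 / of_nat (subspace_dim (N ^ b) (H N b))) \<cdot>\<^sub>m
     ptrace_mid (N ^ a) (N ^ b) (N ^ c) (JW3 N a b c)"

end

theory Submission
  imports Defs "Jordan_Normal_Form.DL_Rank"
begin

text \<open>
  The matrix entries of $x_{a,b,c}$ are the numbers
  $\mathrm{Tr}(P_{a+b+c}(A \otimes 1_b \otimes C)) / d_b$ for matrix units $A$ and $C$, so it suffices
  to show that $\mathrm{Tr}(P_{a+b+c}(A \otimes 1_b \otimes C))$ differs from
  $\frac{d_{a+b+c}}{d_a d_c} \mathrm{Tr}(P_a A) \mathrm{Tr}(P_c C)$ by an amount bounded in $b$; then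
  $d_b \geq q^{-b}$ and $d_{a+b+c} / d_b \rightarrow q^{-(a+c)}$ give the theorem with
  $\lambda_{a,c} = q^{-(a+c)} / (d_a d_c)$. Since partial traces of $P_n$ are multiples of smaller
  projections, one may assume $\mathrm{Tr}(P_c C) = 0$. Expanding $P_{a+b+c}$ along its first leg then
  expresses the partial trace $X_{a,b} \in B(H_a)$ of $P_{a+b+c}(1 \otimes 1_b \otimes C)$ through
  $X_{a-1,b}$, a rotated copy of $X_{a,b-1}$ with coefficient at most $1/2$ in absolute value, and a
  bounded remainder. Hence $X_{a,b}$ is bounded in $b$, by induction on $a$.
\<close>

section \<open>Words and the Jones-Wenzl kernel\<close>

text \<open>The difficulty is uniformity in b. The trace of P_(a+b+c) grows like q^(-b), so a
  bounded error requires a genuine cancellation. The condition Tr(P_c C) = 0 supplies it by forcing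
  X_(0,b) = 0; for C = 1 one would already have X_(0,b) = d_(b+c). The remainder stays bounded
  because it comes from pairs removed near the right end: their coefficients are at most d_c / d_n,
  n + 1 being the total number of legs, and this offsets a trace estimate of order d_n.

  The recursion needs a norm that survives the rotation. The Hilbert-Schmidt norm does, since a
  rotation only permutes matrix entries; the operator norm does not. Each step in a costs a factor
  sqrt N, which is harmless for fixed a, while each step in b halves the old error, so that errors
  do not accumulate.

  Everything is done with a real kernel on words, which index the canonical basis of the tensor
  powers. Two facts determine it: its rows are harmonic, and it reproduces harmonic functions.
  Symmetry, reflection and idempotence follow from these; the recursion, which treats the two ends
  differently, is used again only for traces and for the expansion.\<close>

definition words :: "nat \<Rightarrow> nat \<Rightarrow> nat list set" where
  "words N n = {w. length w = n \<and> set w \<subseteq> {..<N}}"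

text \<open>The dimensions d_n as dictated by the fusion rule for u^1 and u^n. The link with
  \<open>subspace_dim\<close> is made later, in \<open>subspace_dim_H\<close>, through the trace of
  the kernel.\<close>

fun qdim :: "nat \<Rightarrow> nat \<Rightarrow> real" where
  "qdim N 0 = 1"
| "qdim N (Suc 0) = real N"
| "qdim N (Suc (Suc n)) = real N * qdim N (Suc n) - qdim N n"

text \<open>On basis words the Temperley-Lieb diagram e_1 ... e_(k+1) removes an equal pair at
  positions k and k + 1 and inserts a pair l, l in front, summed over l. In \<open>jw\<close> the
  row letter \<open>i\<close> selects l = i, and the second copy of it remains in front of the
  excised word.\<close>

definition excise :: "nat \<Rightarrow> 'a list \<Rightarrow> 'a list" where
  "excise k y = take k y @ drop (k + 2) y"

text \<open>
  The matrix entries of the Jones-Wenzl projection, read off from the one-sided expansion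
  $P_{n+1} = (1 \otimes P_n) \sum_{k=0}^{n} (-1)^k \frac{d_{n-k}}{d_n} e_1 \cdots e_k$
  of Frenkel and Khovanov; the summation index below is $k - 1$. The values are only meaningful
  when both words have the same length.
\<close>

primrec jw :: "nat \<Rightarrow> nat list \<Rightarrow> nat list \<Rightarrow> real" where
  "jw N [] y = of_bool (y = [])"
| "jw N (i # x) y = of_bool (hd y = i) * jw N x (tl y)
     + (\<Sum>k<length x. (-1) ^ Suc k * qdim N (length x - 1 - k) / qdim N (length x)
          * (of_bool (y ! k = y ! Suc k) * jw N x (i # excise k y)))"

lemma words_0 [simp]: "words N 0 = {[]}"
  by (auto simp: words_def)

lemma words_Suc: "words N (Suc n) = (\<lambda>(i, w). i # w) ` ({..<N} \<times> words N n)"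
  by (auto simp: words_def length_Suc_conv image_iff)

lemma finite_words [simp]: "finite (words N n)"
  using finite_lists_length_eq[of "{..<N}" n] by (simp add: words_def conj_commute)

lemma Cons_in_words [simp]: "i # w \<in> words N (Suc n) \<longleftrightarrow> i < N \<and> w \<in> words N n"
  by (auto simp: words_def)

lemma append_in_words: "u \<in> words N m \<Longrightarrow> v \<in> words N n \<Longrightarrow> u @ v \<in> words N (m + n)"
  by (auto simp: words_def)

lemma sum_words_Suc: "(\<Sum>w\<in>words N (Suc n). f w) = (\<Sum>i<N. \<Sum>w\<in>words N n. f (i # w))"
  by (subst words_Suc, subst sum.reindex)
     (auto simp: inj_on_def sum.cartesian_product intro!: sum.cong)

lemma sum_words_add:
  "(\<Sum>w\<in>words N (m + n). f w) = (\<Sum>u\<in>words N m. \<Sum>v\<in>words N n. f (u @ v))"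
  by (induction m arbitrary: f) (simp_all add: sum_words_Suc)

lemma sum_words_rev: "(\<Sum>w\<in>words N n. f (rev w)) = (\<Sum>w\<in>words N n. f w)"
  by (rule sum.reindex_bij_witness[of _ rev rev]) (auto simp: words_def)

lemma length_words: "w \<in> words N n \<Longrightarrow> length w = n"
  by (simp add: words_def)

lemma sum_words_pair:
  assumes "k + 2 \<le> n"
  shows "(\<Sum>y\<in>words N n. of_bool (y ! k = y ! Suc k) * g y :: real) =
    (\<Sum>u\<in>words N k. \<Sum>v\<in>words N (n - k - 2). \<Sum>l<N. g (u @ [l, l] @ v))"
proof -
  define m where "m = n - k - 2"
  have n: "n = k + Suc (Suc m)"
    using assms by (simp add: m_def)
  have "(\<Sum>y\<in>words N n. of_bool (y ! k = y ! Suc k) * g y) =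
    (\<Sum>u\<in>words N k. \<Sum>l<N. \<Sum>l'<N. \<Sum>v\<in>words N m. of_bool (l = l') * g (u @ l # l' # v))"
    unfolding n sum_words_add sum_words_Suc
    by (intro sum.cong refl) (simp add: nth_append length_words)
  also have "\<dots> = (\<Sum>u\<in>words N k. \<Sum>l<N. \<Sum>v\<in>words N m. g (u @ l # l # v))"
  proof (intro sum.cong refl)
    fix u l assume "l \<in> {..<N}"
    have "(\<Sum>l'<N. \<Sum>v\<in>words N m. of_bool (l = l') * g (u @ l # l' # v)) =
      (\<Sum>l'<N. if l' = l then (\<Sum>v\<in>words N m. g (u @ l # l # v)) else 0)"
      by (intro sum.cong) auto
    with \<open>l \<in> {..<N}\<close> show "(\<Sum>l'<N. \<Sum>v\<in>words N m. of_bool (l = l') * g (u @ l # l' # v)) =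
        (\<Sum>v\<in>words N m. g (u @ l # l # v))"
      by simp
  qed
  also have "\<dots> = (\<Sum>u\<in>words N k. \<Sum>v\<in>words N m. \<Sum>l<N. g (u @ [l, l] @ v))"
    by (intro sum.cong refl) (simp add: sum.swap[of _ "{..<N}"])
  finally show ?thesis by (simp add: m_def)
qed

lemma excise_left: "k + 2 \<le> length u \<Longrightarrow> excise k (u @ w) = excise k u @ w"
  by (simp add: excise_def)

lemma excise_right: "length u \<le> k \<Longrightarrow> excise k (u @ w) = u @ excise (k - length u) w"
  by (simp add: excise_def Suc_diff_le)

lemma length_excise: "k + 2 \<le> length u \<Longrightarrow> length (excise k u) = length u - 2"
  by (simp add: excise_def)

lemma set_excise: "set (excise k u) \<subseteq> set u"
  by (auto simp: excise_def dest: in_set_takeD in_set_dropD)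

lemma excise_pair: "excise (length u) (u @ [l, l'] @ v) = u @ v"
  by (simp add: excise_def)

lemma excise_words: "y \<in> words N n \<Longrightarrow> k + 2 \<le> n \<Longrightarrow> excise k y \<in> words N (n - 2)"
  using set_excise[of k y] by (auto simp: words_def length_excise)

text \<open>Harmonic functions on words of length n are the coordinate functions of the vectors in \<^term>\<open>H N n\<close>.\<close>

definition harmonic :: "nat \<Rightarrow> nat \<Rightarrow> (nat list \<Rightarrow> real) \<Rightarrow> bool" where
  "harmonic N n f \<longleftrightarrow> (\<forall>u v. length u + length v + 2 = n \<longrightarrow> set u \<subseteq> {..<N} \<longrightarrow> set v \<subseteq> {..<N} \<longrightarrow>
     (\<Sum>l<N. f (u @ [l, l] @ v)) = 0)"

lemma harmonicD:
  assumes "harmonic N n f" "u \<in> words N k" "v \<in> words N m" "k + m + 2 = n"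
  shows "(\<Sum>l<N. f (u @ [l, l] @ v)) = 0"
  using assms by (auto simp: harmonic_def words_def)

lemma harmonic_subword:
  assumes "harmonic N (k + n + m) f" "p \<in> words N k" "r \<in> words N m"
  shows "harmonic N n (\<lambda>t. f (p @ t @ r))"
  unfolding harmonic_def
proof (intro allI impI)
  fix u v assume *: "length u + length v + 2 = n" "set u \<subseteq> {..<N}" "set v \<subseteq> {..<N}"
  have "(\<Sum>l<N. f ((p @ u) @ [l, l] @ (v @ r))) = 0"
    by (rule harmonicD[OF assms(1), where k = "k + length u" and m = "length v + m"])
       (use * assms(2,3) in \<open>auto simp: words_def\<close>)
  then show "(\<Sum>l<N. f (p @ (u @ [l, l] @ v) @ r)) = 0" by simp
qed

lemma harmonic_rev:
  assumes "harmonic N n f"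
  shows "harmonic N n (\<lambda>t. f (rev t))"
  unfolding harmonic_def
proof (intro allI impI)
  fix u v assume *: "length u + length v + 2 = n" "set u \<subseteq> {..<N}" "set v \<subseteq> {..<N}"
  have "(\<Sum>l<N. f (rev v @ [l, l] @ rev u)) = 0"
    by (rule harmonicD[OF assms, where k = "length v" and m = "length u"])
       (use * in \<open>auto simp: words_def\<close>)
  then show "(\<Sum>l<N. f (rev (u @ [l, l] @ v))) = 0" by simp
qed

section \<open>The kernel as orthogonal projection onto harmonic functions, and its traces\<close>

context
  fixes N :: nat
  assumes N: "N > 2"
begin

text \<open>Here N > 2 is decisive: for N = 2 the recursion yields n + 1. The doubling is the source
  of the contraction rate 1/2 in \<open>slice_bounded\<close>.\<close>

lemma qdim_growth: "qdim N n > 0 \<and> 2 * qdim N n \<le> qdim N (Suc n)"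
proof (induction n)
  case (Suc n)
  have "3 * qdim N (Suc n) \<le> real N * qdim N (Suc n)"
    using Suc N by (intro mult_right_mono) auto
  moreover have "qdim N n \<le> qdim N (Suc n)"
    using Suc by linarith
  ultimately show ?case using Suc by (simp only: qdim.simps) linarith
qed (use N in simp)

lemma qdim_pos [simp]: "qdim N n > 0"
  using qdim_growth by blast

lemma qdim_nonzero [simp]: "qdim N n \<noteq> 0"
  using qdim_pos[of n] by linarith

lemma qdim_mono: "m \<le> n \<Longrightarrow> qdim N m \<le> qdim N n"
  by (rule lift_Suc_mono_le[of "qdim N"]) (use qdim_growth qdim_pos in \<open>smt (verit)\<close>)

text \<open>Let j = \<open>length u\<close>. In the expansion along the first row letter, a removed
  pair disjoint from positions j and j + 1 leaves a contraction of the shorter kernel, which is zero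
  by induction. Removed pairs at j - 1, j and j + 1 all leave the same value J, with weights 1, N
  and 1; for j = 0 the first summand of the recursion replaces the pair at j - 1. The three
  coefficients cancel by the recursion of \<open>qdim\<close>.\<close>

lemma jw_contract:
  assumes "x \<in> words N (length u + length v + 2)" "set u \<subseteq> {..<N}" "set v \<subseteq> {..<N}"
  shows "(\<Sum>l<N. jw N x (u @ [l, l] @ v)) = 0"
  using assms
proof (induction x arbitrary: u v)
  case Nil
  then show ?case by (auto simp: words_def)
next
  case (Cons i x)
  define j where "j = length u"
  define n where "n = length x"
  have n: "n = j + length v + 1" and i: "i < N" and x: "x \<in> words N (j + length v + 1)"
    using Cons.prems by (auto simp: words_def j_def n_def)
  define J where "J = jw N x (i # u @ v)"
  define cf where "cf k = (-1) ^ Suc k * qdim N (n - 1 - k) / qdim N n" for k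
  define S where "S k = (\<Sum>l<N. of_bool ((u @ [l, l] @ v) ! k = (u @ [l, l] @ v) ! Suc k)
      * jw N x (i # excise k (u @ [l, l] @ v)))" for k
  \<comment> \<open>With \<open>u\<close> and \<open>v\<close> both empty the truncated subtraction
    would give the wrong length, hence the last condition.\<close>
  have IH: "(\<Sum>l<N. jw N x (u' @ [l, l] @ v')) = 0"
    if "length u' + length v' = j + length v - 1" "set u' \<subseteq> {..<N}" "set v' \<subseteq> {..<N}" "u \<noteq> [] \<or> v \<noteq> []"
    for u' v'
  proof -
    have "length u' + length v' + 2 = j + length v + 1"
      using that by (cases u; cases v) (auto simp: j_def)
    then show ?thesis using Cons.IH[of u' v'] that x by simp
  qed
  have S_left: "S k = 0" if "k + 1 < j" for k
  proof -
    have "S k = (\<Sum>l<N. of_bool (u ! k = u ! Suc k) * jw N x ((i # excise k u) @ [l, l] @ v))"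
      unfolding S_def using that by (intro sum.cong refl) (simp add: nth_append j_def excise_left)
    also have "\<dots> = of_bool (u ! k = u ! Suc k) * (\<Sum>l<N. jw N x ((i # excise k u) @ [l, l] @ v))"
      by (simp add: sum_distrib_left)
    also have "(\<Sum>l<N. jw N x ((i # excise k u) @ [l, l] @ v)) = 0"
    proof (rule IH)
      show "length (i # excise k u) + length v = j + length v - 1"
        using that by (simp add: j_def length_excise)
      show "set (i # excise k u) \<subseteq> {..<N}"
        using i Cons.prems(2) set_excise[of k u] by auto
    qed (use that Cons.prems in \<open>auto simp: j_def\<close>)
    finally show ?thesis by simp
  qed
  have S_right: "S k = 0" if "j + 1 < k" "k < n" for k
  proof -
    define k' where "k' = k - j - 2"
    have k: "k = j + 2 + k'" using that by (simp add: k'_def)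
    have len: "k' + 2 \<le> length v" using that n by (simp add: k)
    have "S k = (\<Sum>l<N. of_bool (v ! k' = v ! Suc k') * jw N x ((i # u) @ [l, l] @ excise k' v))"
      unfolding S_def
    proof (intro sum.cong refl)
      fix l
      have "excise k ((u @ [l, l]) @ v) = (u @ [l, l]) @ excise k' v"
        using excise_right[of "u @ [l, l]" k v] by (simp add: k j_def)
      moreover have "((u @ [l, l]) @ v) ! k = v ! k'" "((u @ [l, l]) @ v) ! Suc k = v ! Suc k'"
        by (simp_all add: k j_def nth_append)
      ultimately show "of_bool ((u @ [l, l] @ v) ! k = (u @ [l, l] @ v) ! Suc k) * jw N x (i # excise k (u @ [l, l] @ v)) =
          of_bool (v ! k' = v ! Suc k') * jw N x ((i # u) @ [l, l] @ excise k' v)"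
        by simp
    qed
    also have "\<dots> = of_bool (v ! k' = v ! Suc k') * (\<Sum>l<N. jw N x ((i # u) @ [l, l] @ excise k' v))"
      by (simp add: sum_distrib_left)
    also have "(\<Sum>l<N. jw N x ((i # u) @ [l, l] @ excise k' v)) = 0"
    proof (rule IH)
      show "length (i # u) + length (excise k' v) = j + length v - 1"
        using len by (simp add: j_def length_excise)
      show "set (excise k' v) \<subseteq> {..<N}"
        using Cons.prems(3) set_excise[of k' v] by auto
    qed (use i len Cons.prems in auto)
    finally show ?thesis by simp
  qed
  have S_mid: "S j = real N * J"
    unfolding S_def J_def using excise_pair[of u _ _ v] by (simp add: nth_append j_def)
  have S_pre: "S k = J" if jk: "j = Suc k" for k
  proof -
    obtain u' m where u: "u = u' @ [m]" using jk by (cases u rule: rev_cases) (auto simp: j_def)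
    have k: "k = length u'" using jk by (simp add: j_def u)
    have "S k = (\<Sum>l<N. if l = m then J else 0)"
      unfolding S_def J_def k by (intro sum.cong refl) (auto simp: u nth_append excise_def)
    with Cons.prems show ?thesis by (simp add: u)
  qed
  have S_post: "S (Suc j) = J" if ne: "v \<noteq> []"
  proof -
    obtain m v' where v: "v = m # v'" using ne by (cases v) auto
    have "S (Suc j) = (\<Sum>l<N. if l = m then J else 0)"
      unfolding S_def J_def j_def by (intro sum.cong refl) (auto simp: v nth_append excise_def)
    with Cons.prems show ?thesis by (simp add: v)
  qed
  have head: "(\<Sum>l<N. of_bool (hd (u @ [l, l] @ v) = i) * jw N x (tl (u @ [l, l] @ v))) = of_bool (j = 0) * J"
  proof (cases u)
    case Nil
    have "(\<Sum>l<N. of_bool (hd (u @ [l, l] @ v) = i) * jw N x (tl (u @ [l, l] @ v))) =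
        (\<Sum>l<N. if l = i then J else 0)"
      by (intro sum.cong refl) (auto simp: Nil J_def)
    then show ?thesis using i by (simp add: Nil j_def)
  next
    case (Cons m u')
    have "(\<Sum>l<N. of_bool (hd (u @ [l, l] @ v) = i) * jw N x (tl (u @ [l, l] @ v))) =
        of_bool (m = i) * (\<Sum>l<N. jw N x (u' @ [l, l] @ v))"
      by (simp add: Cons sum_distrib_left)
    also have "(\<Sum>l<N. jw N x (u' @ [l, l] @ v)) = 0"
      by (rule IH) (use Cons Cons.prems in \<open>auto simp: j_def\<close>)
    finally show ?thesis by (simp add: Cons j_def)
  qed
  have S: "S k = (of_bool (j = Suc k) + real N * of_bool (k = j) + of_bool (k = Suc j)) * J"
    if "k < n" for k
  proof -
    consider "k + 1 < j" | "j = Suc k" | "k = j" | "k = Suc j" | "j + 1 < k" by linarith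
    then show ?thesis
    proof cases
      case 4
      with that n have "v \<noteq> []" by auto
      with 4 S_post show ?thesis by simp
    qed (use S_left S_right S_mid S_pre that in auto)
  qed
  have "(\<Sum>l<N. jw N (i # x) (u @ [l, l] @ v)) = of_bool (j = 0) * J + (\<Sum>k<n. cf k * S k)"
    unfolding jw.simps sum.distrib head S_def cf_def n_def
    by (subst sum.swap) (simp only: sum_distrib_left mult.assoc)
  also have "(\<Sum>k<n. cf k * S k) = J * (\<Sum>k<n. cf k * of_bool (j = Suc k) + cf k * real N * of_bool (k = j) + cf k * of_bool (k = Suc j))"
    unfolding sum_distrib_left by (intro sum.cong refl) (simp add: S algebra_simps)
  also have "(\<Sum>k<n. cf k * of_bool (j = Suc k) + cf k * real N * of_bool (k = j) + cf k * of_bool (k = Suc j)) =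
      (\<Sum>k<n. cf k * of_bool (j = Suc k)) + cf j * real N + (if v \<noteq> [] then cf (Suc j) else 0)"
  proof -
    have "(\<Sum>k<n. g k * of_bool (k = m)) = (if m < n then g m else 0)" for g :: "nat \<Rightarrow> real" and m
      by (simp add: of_bool_def if_distrib[of "\<lambda>t. _ * t"] cong: if_cong)
    note delta = this
    have "j < n" "Suc j < n \<longleftrightarrow> v \<noteq> []" using n by auto
    then show ?thesis
      unfolding sum.distrib delta[of "\<lambda>k. cf k * real N" j] delta[of cf "Suc j"] by simp
  qed
  also have "(\<Sum>k<n. cf k * of_bool (j = Suc k)) = (if j = 0 then 0 else cf (j - 1))"
  proof (cases j)
    case (Suc i)
    have "(\<Sum>k<n. cf k * of_bool (j = Suc k)) = (\<Sum>k<n. if k = i then cf k else 0)"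
      by (intro sum.cong refl) (auto simp: Suc)
    with Suc n show ?thesis by simp
  qed simp
  also have "of_bool (j = 0) * J + J * ((if j = 0 then 0 else cf (j - 1)) + cf j * real N + (if v \<noteq> [] then cf (Suc j) else 0)) =
      J * ((if j = 0 then 1 else cf (j - 1)) + cf j * real N + (if v \<noteq> [] then cf (Suc j) else 0))"
    by (simp add: algebra_simps)
  \<comment> \<open>All three coefficients are brought to a form that is also right at the ends: for
    j = 0 the weight 1 equals d_n / d_n, and for empty \<open>v\<close> the missing pair at j + 1
    has weight N d_0 - d_1 = 0.\<close>
  also have "(if j = 0 then 1 else cf (j - 1)) = (-1) ^ j * qdim N (Suc (length v)) / qdim N n"
    using n by (cases j) (auto simp: cf_def)
  also have "cf j = - ((-1) ^ j * qdim N (length v) / qdim N n)"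
    using n by (simp add: cf_def)
  also have "(if v \<noteq> [] then cf (Suc j) else 0) =
      (-1) ^ j * (real N * qdim N (length v) - qdim N (Suc (length v))) / qdim N n"
    using n by (cases v) (auto simp: cf_def)
  finally show ?case by (simp add: field_simps)
qed


lemma harmonic_jw: "x \<in> words N n \<Longrightarrow> harmonic N n (jw N x)"
  using jw_contract by (auto simp: harmonic_def)

text \<open>\<open>jw_contract\<close> and \<open>jw_reproduces\<close> together say that \<^const>\<open>jw\<close> is the kernel of the orthogonal projection.\<close>

lemma jw_reproduces:
  assumes "harmonic N n f" "x \<in> words N n"
  shows "(\<Sum>y\<in>words N n. jw N x y * f y) = f x"
  using assms
proof (induction x arbitrary: n f)
  case Nil
  then have "n = 0" by (simp add: words_def)
  then show ?case by simp
next
  case (Cons i x)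
  define m where "m = length x"
  have n: "n = Suc m" and i: "i < N" and x: "x \<in> words N m"
    using Cons.prems(2) by (auto simp: words_def m_def)
  define cf where "cf k = (-1) ^ Suc k * qdim N (m - 1 - k) / qdim N m" for k
  have "(\<Sum>y\<in>words N n. jw N (i # x) y * f y) =
      (\<Sum>y\<in>words N n. of_bool (hd y = i) * jw N x (tl y) * f y)
      + (\<Sum>k<m. cf k * (\<Sum>y\<in>words N n. of_bool (y ! k = y ! Suc k) * (jw N x (i # excise k y) * f y)))"
    unfolding jw.simps distrib_right sum.distrib cf_def m_def
    by (simp only: sum_distrib_left sum_distrib_right mult.assoc sum.swap[of _ "{..<length x}"])
  also have "(\<Sum>y\<in>words N n. of_bool (hd y = i) * jw N x (tl y) * f y) =
      (\<Sum>j<N. if j = i then (\<Sum>w\<in>words N m. jw N x w * f (i # w)) else 0)"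
    unfolding n sum_words_Suc by (intro sum.cong refl) auto
  also have "\<dots> = (\<Sum>w\<in>words N m. jw N x w * f (i # w))"
    using i by simp
  also have "\<dots> = f (i # x)"
  proof (rule Cons.IH[OF _ x])
    show "harmonic N m (\<lambda>w. f (i # w))"
      using harmonic_subword[of N 1 m 0 f "[i]" "[]"] Cons.prems(1) i by (simp add: n words_def)
  qed
  also have "(\<Sum>k<m. cf k * (\<Sum>y\<in>words N n. of_bool (y ! k = y ! Suc k) * (jw N x (i # excise k y) * f y))) = 0"
  proof (intro sum.neutral ballI)
    fix k assume k: "k \<in> {..<m}"
    have "(\<Sum>y\<in>words N n. of_bool (y ! k = y ! Suc k) * (jw N x (i # excise k y) * f y)) =
        (\<Sum>u\<in>words N k. \<Sum>v\<in>words N (n - k - 2). \<Sum>l<N. jw N x (i # excise k (u @ [l, l] @ v)) * f (u @ [l, l] @ v))"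
      by (rule sum_words_pair) (use k n in auto)
    \<comment> \<open>Excision forgets the doubled letter, so only f depends on l and its
      contraction can be factored out.\<close>
    also have "\<dots> = (\<Sum>u\<in>words N k. \<Sum>v\<in>words N (n - k - 2). jw N x (i # u @ v) * (\<Sum>l<N. f (u @ [l, l] @ v)))"
      by (intro sum.cong refl) (simp add: sum_distrib_left excise_def length_words)
    also have "\<dots> = 0"
    proof (intro sum.neutral ballI)
      fix u v assume "u \<in> words N k" "v \<in> words N (n - k - 2)"
      then have "(\<Sum>l<N. f (u @ [l, l] @ v)) = 0"
        by (rule harmonicD[OF Cons.prems(1)]) (use k n in auto)
      then show "jw N x (i # u @ v) * (\<Sum>l<N. f (u @ [l, l] @ v)) = 0" by simp
    qed
    finally show "cf k * (\<Sum>y\<in>words N n. of_bool (y ! k = y ! Suc k) * (jw N x (i # excise k y) * f y)) = 0"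
      by simp
  qed
  finally show ?case by simp
qed

text \<open>Reproduction applied to a row of the kernel, that is, P P^T = P^T. The left side is
  symmetric in x and z, so the symmetry of the kernel, invisible in its recursion, follows at
  once.\<close>

lemma jw_gram:
  assumes "x \<in> words N n" "z \<in> words N n"
  shows "(\<Sum>y\<in>words N n. jw N x y * jw N z y) = jw N z x"
  using jw_reproduces[OF harmonic_jw[OF assms(2)] assms(1)] .

lemma jw_sym:
  assumes "x \<in> words N n" "z \<in> words N n"
  shows "jw N x z = jw N z x"
  using jw_gram[OF assms] jw_gram[OF assms(2,1)] by (simp add: mult.commute)

lemma harmonic_jw_left: "y \<in> words N n \<Longrightarrow> harmonic N n (\<lambda>x. jw N x y)"
  unfolding harmonic_def
proof (intro allI impI)
  fix u v assume *: "y \<in> words N n" "length u + length v + 2 = n" "set u \<subseteq> {..<N}" "set v \<subseteq> {..<N}"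
  have "(\<Sum>l<N. jw N (u @ [l, l] @ v) y) = (\<Sum>l<N. jw N y (u @ [l, l] @ v))"
    by (intro sum.cong refl jw_sym) (use * in \<open>auto simp: words_def\<close>)
  also have "\<dots> = 0"
    using * harmonic_jw[of y n] by (auto simp: harmonic_def)
  finally show "(\<Sum>l<N. jw N (u @ [l, l] @ v) y) = 0" .
qed

lemma jw_absorb:
  assumes "x \<in> words N (k + n + m)" "p \<in> words N k" "t \<in> words N n" "r \<in> words N m"
  shows "(\<Sum>s\<in>words N n. jw N x (p @ s @ r) * jw N s t) = jw N x (p @ t @ r)"
proof -
  have "(\<Sum>s\<in>words N n. jw N x (p @ s @ r) * jw N s t) = (\<Sum>s\<in>words N n. jw N t s * jw N x (p @ s @ r))"
    by (intro sum.cong refl) (use assms jw_sym[of _ n t] in \<open>simp add: mult.commute\<close>)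
  also have "\<dots> = jw N x (p @ t @ r)"
    by (rule jw_reproduces[OF harmonic_subword[OF harmonic_jw]]) (use assms in auto)
  finally show ?thesis .
qed

text \<open>Reversal preserves harmonicity, and a reproducing kernel with harmonic rows is unique.
  This transfers to the right end what the recursion gives at the left end.\<close>

lemma jw_rev:
  assumes x: "x \<in> words N n" and z: "z \<in> words N n"
  shows "jw N (rev x) (rev z) = jw N x z"
proof -
  have rx: "rev x \<in> words N n" using x by (simp add: words_def)
  have "jw N (rev x) (rev z) = (\<Sum>y\<in>words N n. jw N z y * jw N (rev x) (rev y))"
    by (rule jw_reproduces[OF harmonic_rev[OF harmonic_jw[OF rx]] z, symmetric])
  also have "\<dots> = (\<Sum>y\<in>words N n. jw N (rev x) y * jw N z (rev y))"
    using sum_words_rev[of "\<lambda>y. jw N (rev x) y * jw N z (rev y)" N n] by (simp add: mult.commute)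
  also have "\<dots> = jw N z (rev (rev x))"
    by (rule jw_reproduces[OF harmonic_rev[OF harmonic_jw[OF z]] rx])
  finally show ?thesis using jw_sym[OF x z] by simp
qed

text \<open>The first summand contributes N. The pair k = 0 removes \<open>i\<close> with the first
  letter of y and puts \<open>i\<close> back, contributing -d_(n-1) / d_n. For every other pair the
  letter \<open>i\<close> becomes doubled in front, and the sum over it is a vanishing contraction.
  Finally N - d_(n-1) / d_n = d_(n+1) / d_n.\<close>

lemma jw_trace_left_1:
  assumes x: "x \<in> words N n" and y: "y \<in> words N n"
  shows "(\<Sum>i<N. jw N (i # x) (i # y)) = qdim N (Suc n) / qdim N n * jw N x y"
proof (cases n)
  case 0
  with x y show ?thesis by simp
next
  case (Suc m)
  define cf where "cf k = (-1) ^ Suc k * qdim N (n - 1 - k) / qdim N n" for k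
  define E where "E k = (\<Sum>i<N. of_bool ((i # y) ! k = (i # y) ! Suc k) * jw N x (i # excise k (i # y)))" for k
  have "(\<Sum>i<N. jw N (i # x) (i # y)) = real N * jw N x y + (\<Sum>k<n. cf k * E k)"
    unfolding jw.simps sum.distrib E_def cf_def length_words[OF x]
    by (subst sum.swap) (simp only: sum_distrib_left mult.assoc list.sel, simp)
  also have "(\<Sum>k<n. cf k * E k) = cf 0 * E 0 + (\<Sum>k<m. cf (Suc k) * E (Suc k))"
    unfolding Suc by (rule sum.lessThan_Suc_shift)
  also have "(\<Sum>k<m. cf (Suc k) * E (Suc k)) = 0"
  proof (intro sum.neutral ballI)
    fix k assume k: "k \<in> {..<m}"
    have ex: "excise k y \<in> words N (n - 2)"
      by (rule excise_words[OF y]) (use k Suc in auto)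
    have "E (Suc k) = of_bool (y ! k = y ! Suc k) * (\<Sum>i<N. jw N x ([] @ [i, i] @ excise k y))"
      by (simp add: E_def sum_distrib_left excise_def)
    also have "(\<Sum>i<N. jw N x ([] @ [i, i] @ excise k y)) = 0"
      by (rule harmonicD[OF harmonic_jw[OF x] _ ex, where k = 0]) (use k Suc in auto)
    finally show "cf (Suc k) * E (Suc k) = 0" by simp
  qed
  also have "E 0 = jw N x y"
  proof -
    obtain j y' where y': "y = j # y'" "j < N"
      using y by (cases y) (auto simp: Suc words_def)
    have "E 0 = (\<Sum>i<N. if i = j then jw N x y else 0)"
      unfolding E_def by (intro sum.cong refl) (auto simp: y' excise_def)
    then show ?thesis using y' by simp
  qed
  also have "real N * jw N x y + (cf 0 * jw N x y + 0) = qdim N (Suc n) / qdim N n * jw N x y"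
    by (simp add: cf_def Suc field_simps)
  finally show ?thesis .
qed

lemma jw_trace_left:
  assumes "x \<in> words N n" "y \<in> words N n"
  shows "(\<Sum>u\<in>words N m. jw N (u @ x) (u @ y)) = qdim N (m + n) / qdim N n * jw N x y"
proof (induction m)
  case (Suc m)
  have "(\<Sum>u\<in>words N (Suc m). jw N (u @ x) (u @ y)) =
      (\<Sum>u\<in>words N m. \<Sum>i<N. jw N (i # (u @ x)) (i # (u @ y)))"
    by (subst sum.swap) (simp only: sum_words_Suc append_Cons)
  also have "\<dots> = (\<Sum>u\<in>words N m. qdim N (Suc (m + n)) / qdim N (m + n) * jw N (u @ x) (u @ y))"
    by (intro sum.cong refl jw_trace_left_1) (use assms append_in_words in auto)
  also have "\<dots> = qdim N (Suc m + n) / qdim N n * jw N x y"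
    unfolding sum_distrib_left[symmetric] Suc by simp
  finally show ?case .
qed simp

lemma jw_trace_right:
  assumes x: "x \<in> words N n" and y: "y \<in> words N n"
  shows "(\<Sum>u\<in>words N m. jw N (x @ u) (y @ u)) = qdim N (m + n) / qdim N n * jw N x y"
proof -
  have "(\<Sum>u\<in>words N m. jw N (x @ u) (y @ u)) = (\<Sum>u\<in>words N m. jw N (rev u @ rev x) (rev u @ rev y))"
  proof (intro sum.cong refl)
    fix u assume "u \<in> words N m"
    with x y show "jw N (x @ u) (y @ u) = jw N (rev u @ rev x) (rev u @ rev y)"
      using jw_rev[of "x @ u" "n + m" "y @ u"] by (simp add: append_in_words)
  qed
  also have "\<dots> = (\<Sum>u\<in>words N m. jw N (u @ rev x) (u @ rev y))"
    by (rule sum_words_rev)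
  also have "\<dots> = qdim N (m + n) / qdim N n * jw N (rev x) (rev y)"
    by (rule jw_trace_left) (use x y in \<open>auto simp: words_def\<close>)
  finally show ?thesis using jw_rev[OF x y] by simp
qed

lemma jw_trace: "(\<Sum>u\<in>words N n. jw N u u) = qdim N n"
  using jw_trace_left[of "[]" 0 "[]" n] by simp

lemma jw_diag_nonneg:
  assumes "x \<in> words N n"
  shows "jw N x x \<ge> 0"
  using jw_gram[OF assms assms] by (metis sum_nonneg zero_le_square)

text \<open>By \<open>jw_gram\<close>, inner products of rows are entries of the kernel; the bound
  is the nonnegativity of the squared norms of the sum and the difference of the two rows.\<close>

lemma jw_le_diag:
  assumes x: "x \<in> words N n" and y: "y \<in> words N n"
  shows "\<bar>jw N x y\<bar> \<le> (jw N x x + jw N y y) / 2"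
proof -
  have "0 \<le> (\<Sum>w\<in>words N n. (jw N x w + s * jw N y w)\<^sup>2)" for s
    by (intro sum_nonneg) simp
  also have "(\<Sum>w\<in>words N n. (jw N x w + s * jw N y w)\<^sup>2) = jw N x x + 2 * s * jw N x y + s\<^sup>2 * jw N y y" for s
    using jw_gram[OF x x] jw_gram[OF y y] jw_gram[OF x y] jw_sym[OF x y]
    by (simp add: power2_eq_square algebra_simps sum.distrib flip: sum_distrib_left)
  finally have "0 \<le> jw N x x + 2 * s * jw N x y + s\<^sup>2 * jw N y y" for s .
  from this[of 1] this[of "-1"] show ?thesis by simp
qed

text \<open>For an orthogonal projection P, the squared norm of P g is the inner product of g with P
  g, so the squared norm of g - P g is the difference of the two sides.\<close>

lemma jw_contraction:
  "(\<Sum>t\<in>words N n. (\<Sum>s\<in>words N n. g s * jw N s t)\<^sup>2) \<le> (\<Sum>s\<in>words N n. (g s)\<^sup>2)"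
proof -
  define h where "h t = (\<Sum>s\<in>words N n. g s * jw N s t)" for t
  have "(\<Sum>t\<in>words N n. (h t)\<^sup>2) = (\<Sum>s\<in>words N n. g s * (\<Sum>t\<in>words N n. jw N s t * h t))"
  proof -
    have "(\<Sum>t\<in>words N n. (h t)\<^sup>2) = (\<Sum>t\<in>words N n. \<Sum>s\<in>words N n. g s * (jw N s t * h t))"
      by (intro sum.cong refl) (simp add: power2_eq_square h_def sum_distrib_right mult.assoc)
    also have "\<dots> = (\<Sum>s\<in>words N n. \<Sum>t\<in>words N n. g s * (jw N s t * h t))"
      by (rule sum.swap)
    finally show ?thesis by (simp only: sum_distrib_left)
  qed
  also have "\<dots> = (\<Sum>s\<in>words N n. g s * h s)"
  proof (intro sum.cong refl)
    fix s assume s: "s \<in> words N n"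
    have "harmonic N n h"
      unfolding harmonic_def
    proof (intro allI impI)
      fix u v assume *: "length u + length v + 2 = n" "set u \<subseteq> {..<N}" "set v \<subseteq> {..<N}"
      have "(\<Sum>l<N. h (u @ [l, l] @ v)) = (\<Sum>r\<in>words N n. g r * (\<Sum>l<N. jw N r (u @ [l, l] @ v)))"
        unfolding h_def by (subst sum.swap) (simp add: sum_distrib_left)
      also have "\<dots> = 0"
        using * harmonic_jw by (intro sum.neutral ballI) (auto simp: harmonic_def)
      finally show "(\<Sum>l<N. h (u @ [l, l] @ v)) = 0" .
    qed
    from jw_reproduces[OF this s] show "g s * (\<Sum>t\<in>words N n. jw N s t * h t) = g s * h s" by simp
  qed
  finally have eq: "(\<Sum>t\<in>words N n. (h t)\<^sup>2) = (\<Sum>s\<in>words N n. g s * h s)" .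
  have "0 \<le> (\<Sum>s\<in>words N n. (g s - h s)\<^sup>2)" by (intro sum_nonneg) simp
  also have "\<dots> = (\<Sum>s\<in>words N n. (g s)\<^sup>2) - (\<Sum>s\<in>words N n. (h s)\<^sup>2)"
    unfolding power2_diff sum.distrib sum_subtractf mult.assoc sum_distrib_left[symmetric] eq by simp
  finally show ?thesis by (simp add: h_def)
qed

end

section \<open>Asymptotic factorization\<close>

text \<open>
  In operator terms, \<^term>\<open>slice N c C b\<close> is
  $(\mathrm{id}_a \otimes \mathrm{Tr}_b \otimes \mathrm{Tr}_c)(P_{a+b+c} (1 \otimes 1 \otimes C))$,
  the index $a$ being the length of the arguments.
\<close>

definition slice ::
    "nat \<Rightarrow> nat \<Rightarrow> (nat list \<Rightarrow> nat list \<Rightarrow> real) \<Rightarrow> nat \<Rightarrow> nat list \<Rightarrow> nat list \<Rightarrow> real" where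
  "slice N c C b s t = (\<Sum>m\<in>words N b. \<Sum>s2\<in>words N c. \<Sum>t2\<in>words N c.
     C t2 s2 * jw N (s @ m @ s2) (t @ m @ t2))"

definition frob :: "nat \<Rightarrow> nat \<Rightarrow> (nat list \<Rightarrow> nat list \<Rightarrow> real) \<Rightarrow> real" where
  "frob N a X = L2_set (\<lambda>(s, t). X s t) (words N a \<times> words N a)"

lemma frob_nonneg: "0 \<le> frob N a X"
  by (simp add: frob_def L2_set_nonneg)

lemma frob_add: "frob N a (\<lambda>s t. X s t + Y s t) \<le> frob N a X + frob N a Y"
  using L2_set_triangle_ineq[of "\<lambda>(s, t). X s t" "\<lambda>(s, t). Y s t" "words N a \<times> words N a"]
  by (simp add: frob_def case_prod_unfold)

lemma frob_scale: "frob N a (\<lambda>s t. r * X s t) = \<bar>r\<bar> * frob N a X"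
proof -
  have "frob N a (\<lambda>s t. r * X s t) = sqrt (r\<^sup>2 * (\<Sum>p\<in>words N a \<times> words N a. (X (fst p) (snd p))\<^sup>2))"
    by (simp add: frob_def L2_set_def case_prod_unfold power_mult_distrib sum_distrib_left)
  then show ?thesis by (simp add: frob_def L2_set_def case_prod_unfold real_sqrt_mult)
qed

lemma frob_eq: "frob N a X = sqrt (\<Sum>s\<in>words N a. \<Sum>t\<in>words N a. (X s t)\<^sup>2)"
  by (simp add: frob_def L2_set_def sum.cartesian_product case_prod_unfold)

lemma frob_cong:
  "(\<And>s t. s \<in> words N a \<Longrightarrow> t \<in> words N a \<Longrightarrow> X s t = Y s t) \<Longrightarrow> frob N a X = frob N a Y"
  by (simp add: frob_eq)

lemma frob_entry: "s \<in> words N a \<Longrightarrow> t \<in> words N a \<Longrightarrow> \<bar>X s t\<bar> \<le> frob N a X"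
  using member_le_L2_set[of "words N a \<times> words N a" "(s, t)" "\<lambda>(s, t). \<bar>X s t\<bar>"]
  by (simp add: frob_def L2_set_def case_prod_unfold)

lemma frob_le_of_entries:
  assumes "\<And>s t. s \<in> words N a \<Longrightarrow> t \<in> words N a \<Longrightarrow> \<bar>X s t\<bar> \<le> K"
  shows "frob N a X \<le> real (card (words N a \<times> words N a)) * K"
proof -
  have "frob N a X \<le> (\<Sum>p\<in>words N a \<times> words N a. \<bar>case p of (s, t) \<Rightarrow> X s t\<bar>)"
    unfolding frob_def by (rule L2_set_le_sum_abs)
  also have "\<dots> \<le> real (card (words N a \<times> words N a)) * K"
    by (rule sum_bounded_above) (use assms in auto)
  finally show ?thesis .
qed

lemma sum_words_snoc: "(\<Sum>w\<in>words N (Suc n). f w) = (\<Sum>w\<in>words N n. \<Sum>i<N. f (w @ [i]))"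
  using sum_words_add[of f N n 1] by (simp add: sum_words_Suc)

text \<open>The rotation exchanges the first row letter and the last column letter, a bijection on
  pairs of words; the sum of squares is merely reordered.\<close>

lemma frob_rotate:
  "frob N (Suc a) (\<lambda>s t. X (tl s @ [last t]) (hd s # butlast t)) = frob N (Suc a) X"
proof -
  have "(\<Sum>s\<in>words N (Suc a). \<Sum>t\<in>words N (Suc a). (X (tl s @ [last t]) (hd s # butlast t))\<^sup>2) =
      (\<Sum>i<N. \<Sum>s\<in>words N a. \<Sum>t\<in>words N a. \<Sum>l<N. (X (s @ [l]) (i # t))\<^sup>2)"
    by (subst sum_words_Suc, subst sum_words_snoc) simp
  also have "\<dots> = (\<Sum>i<N. \<Sum>s\<in>words N a. \<Sum>l<N. \<Sum>t\<in>words N a. (X (s @ [l]) (i # t))\<^sup>2)"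
    by (intro sum.cong refl sum.swap)
  also have "\<dots> = (\<Sum>s\<in>words N a. \<Sum>i<N. \<Sum>l<N. \<Sum>t\<in>words N a. (X (s @ [l]) (i # t))\<^sup>2)"
    by (rule sum.swap)
  also have "\<dots> = (\<Sum>s\<in>words N a. \<Sum>l<N. \<Sum>i<N. \<Sum>t\<in>words N a. (X (s @ [l]) (i # t))\<^sup>2)"
    by (intro sum.cong refl sum.swap)
  also have "\<dots> = (\<Sum>s\<in>words N (Suc a). \<Sum>t\<in>words N (Suc a). (X s t)\<^sup>2)"
    by (subst sum_words_snoc, simp only: sum_words_Suc)
  finally show ?thesis by (simp add: frob_eq)
qed

lemma frob_ampliate:
  "frob N (Suc a) (\<lambda>s t. of_bool (hd t = hd s) * X (tl s) (tl t)) = sqrt (real N) * frob N a X"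
proof -
  have "(\<Sum>s\<in>words N (Suc a). \<Sum>t\<in>words N (Suc a). (of_bool (hd t = hd s) * X (tl s) (tl t))\<^sup>2) =
      (\<Sum>i<N. \<Sum>s\<in>words N a. \<Sum>j<N. if j = i then \<Sum>t\<in>words N a. (X s t)\<^sup>2 else 0)"
    unfolding sum_words_Suc by (intro sum.cong refl) auto
  also have "\<dots> = real N * (\<Sum>s\<in>words N a. \<Sum>t\<in>words N a. (X s t)\<^sup>2)"
    by simp
  finally show ?thesis by (simp add: frob_eq real_sqrt_mult)
qed

section \<open>Trace estimates and the expansion of a slice along its first leg\<close>

context
  fixes N :: nat
  assumes N: "N > 2"
begin

lemma frob_contraction:
  "frob N a (\<lambda>s t'. \<Sum>t\<in>words N a. X s t * jw N t t') \<le> frob N a X"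
  unfolding frob_eq by (intro real_sqrt_le_mono sum_mono jw_contraction[OF N])

lemma diag_sum_le:
  assumes "p \<in> words N k"
  shows "(\<Sum>w\<in>words N n. jw N (p @ w) (p @ w)) \<le> qdim N (k + n)"
proof -
  have "(\<Sum>w\<in>words N n. jw N (p @ w) (p @ w)) \<le> (\<Sum>u\<in>words N k. \<Sum>w\<in>words N n. jw N (u @ w) (u @ w))"
    by (rule member_le_sum[OF assms])
       (auto intro!: sum_nonneg jw_diag_nonneg[OF N] append_in_words)
  also have "\<dots> = qdim N (k + n)"
    using jw_trace[OF N, of "k + n"] by (simp add: sum_words_add)
  finally show ?thesis .
qed

text \<open>Each shortened word arises from N choices of the doubled letter, which gives the factor
  N; what remains is a diagonal sum over words with prefix \<open>i # p\<close>.\<close>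

lemma excised_diag_sum_le:
  assumes p: "p \<in> words N r" and i: "i < N" and k: "r \<le> k" "k + 2 \<le> r + n"
  shows "(\<Sum>w\<in>words N n. of_bool ((p @ w) ! k = (p @ w) ! Suc k) *
            jw N (i # excise k (p @ w)) (i # excise k (p @ w)))
      \<le> real N * qdim N (r + n - 1)"
proof -
  define k' where "k' = k - r"
  define m where "m = n - k' - 2"
  have kk: "k = length p + k'" "k' + 2 \<le> n"
    using k p by (auto simp: k'_def length_words)
  have ip: "i # p \<in> words N (Suc r)" using p i by simp
  have "(\<Sum>w\<in>words N n. of_bool ((p @ w) ! k = (p @ w) ! Suc k) *
            jw N (i # excise k (p @ w)) (i # excise k (p @ w))) =
      (\<Sum>w\<in>words N n. of_bool (w ! k' = w ! Suc k') *
            jw N ((i # p) @ excise k' w) ((i # p) @ excise k' w))"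
    by (intro sum.cong refl) (simp add: kk excise_right nth_append)
  also have "\<dots> = (\<Sum>u\<in>words N k'. \<Sum>v\<in>words N m. \<Sum>l<N.
            jw N ((i # p) @ excise k' (u @ [l, l] @ v)) ((i # p) @ excise k' (u @ [l, l] @ v)))"
    using kk unfolding m_def by (intro sum_words_pair) simp
  also have "\<dots> = (\<Sum>u\<in>words N k'. \<Sum>v\<in>words N m. real N * jw N ((i # p) @ u @ v) ((i # p) @ u @ v))"
    by (intro sum.cong refl) (simp add: excise_def length_words)
  also have "\<dots> = real N * (\<Sum>w\<in>words N (k' + m). jw N ((i # p) @ w) ((i # p) @ w))"
    by (simp only: sum_words_add sum_distrib_left)
  also have "\<dots> \<le> real N * qdim N (Suc r + (k' + m))"
    by (intro mult_left_mono diag_sum_le[OF ip]) simp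
  also have "Suc r + (k' + m) = r + n - 1"
    using kk by (simp add: m_def)
  finally show ?thesis .
qed

text \<open>P_(a+b+c) absorbs P_a on its first legs. In \<open>slice_bounded\<close> this allows P_a
  to be inserted before the expansion, where it annihilates the terms with a pair inside the left
  leg.\<close>

lemma slice_absorb:
  assumes s: "s \<in> words N a" and t: "t \<in> words N a"
  shows "(\<Sum>r\<in>words N a. slice N c C b s r * jw N r t) = slice N c C b s t"
proof -
  have "(\<Sum>r\<in>words N a. slice N c C b s r * jw N r t) =
    (\<Sum>m\<in>words N b. \<Sum>s2\<in>words N c. \<Sum>t2\<in>words N c. \<Sum>r\<in>words N a.
       C t2 s2 * (jw N (s @ m @ s2) (r @ m @ t2) * jw N r t))"
    unfolding slice_def sum_distrib_right mult.assoc
    by (simp only: sum.swap[of _ "words N _" "words N a"])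
  also have "\<dots> = slice N c C b s t"
    unfolding slice_def sum_distrib_left[symmetric]
  proof (intro sum.cong refl)
    fix m s2 t2 assume "m \<in> words N b" "s2 \<in> words N c" "t2 \<in> words N c"
    then show "C t2 s2 * (\<Sum>r\<in>words N a. jw N (s @ m @ s2) (r @ m @ t2) * jw N r t) =
        C t2 s2 * jw N (s @ m @ s2) (t @ m @ t2)"
      using jw_absorb[OF N, of "s @ m @ s2" 0 a "b + c" "[]" t "m @ t2"] s t
      by (simp add: append_in_words)
  qed
  finally show ?thesis .
qed

text \<open>
  The expansion of \<^const>\<open>jw\<close> along the first letter of the row word removes a pair of equal
  neighbouring letters, at positions $k$ and $k + 1$ of the column word \<open>t @ m @ t2\<close>. A pair inside
  \<open>t\<close> disappears after multiplication by $P_a$, a pair inside \<open>m\<close> contributes zero, the pair across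
  the border of \<open>t\<close> and \<open>m\<close> gives a rotated \<^const>\<open>slice\<close>, and the remaining pairs come with
  coefficients small enough to be estimated by the trace.
\<close>

definition expansion_term where
  "expansion_term c C b k s t = (\<Sum>m\<in>words N b. \<Sum>s2\<in>words N c. \<Sum>t2\<in>words N c.
     C t2 s2 * (of_bool ((t @ m @ t2) ! k = (t @ m @ t2) ! Suc k) *
       jw N (tl s @ m @ s2) (hd s # excise k (t @ m @ t2))))"

lemma slice_expand:
  assumes "s \<in> words N (Suc a)" "t \<in> words N (Suc a)"
  shows "slice N c C b s t = of_bool (hd t = hd s) * slice N c C b (tl s) (tl t) +
    (\<Sum>k<a + b + c. (-1) ^ Suc k * qdim N (a + b + c - 1 - k) / qdim N (a + b + c)
       * expansion_term c C b k s t)"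
proof -
  define cf where "cf k = (-1) ^ Suc k * qdim N (a + b + c - 1 - k) / qdim N (a + b + c)" for k
  obtain i s' where s: "s = i # s'" "s' \<in> words N a"
    using assms(1) by (cases s) (auto simp: words_def)
  obtain j t' where t: "t = j # t'" using assms(2) by (cases t) (auto simp: words_def)
  have "jw N (s @ m @ s2) (t @ m @ t2) = of_bool (hd t = i) * jw N (s' @ m @ s2) (tl t @ m @ t2) +
      (\<Sum>k<a + b + c. cf k * (of_bool ((t @ m @ t2) ! k = (t @ m @ t2) ! Suc k) *
         jw N (s' @ m @ s2) (i # excise k (t @ m @ t2))))"
    if "m \<in> words N b" "s2 \<in> words N c" for m s2 t2
    using that s by (simp add: t length_words cf_def add.assoc)
  then have "slice N c C b s t = (\<Sum>m\<in>words N b. \<Sum>s2\<in>words N c. \<Sum>t2\<in>words N c.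
     C t2 s2 * (of_bool (hd t = i) * jw N (s' @ m @ s2) (tl t @ m @ t2) +
      (\<Sum>k<a + b + c. cf k * (of_bool ((t @ m @ t2) ! k = (t @ m @ t2) ! Suc k) *
         jw N (s' @ m @ s2) (i # excise k (t @ m @ t2))))))"
    unfolding slice_def by (intro sum.cong refl) (simp only:)
  also have "\<dots> = of_bool (hd t = i) * slice N c C b s' (tl t) +
     (\<Sum>k<a + b + c. cf k * expansion_term c C b k s t)"
    unfolding slice_def expansion_term_def s distrib_left sum.distrib sum_distrib_left list.sel
    by (simp only: sum.swap[of _ "words N _" "{..<a + b + c}"] mult.left_commute)
  finally show ?thesis by (simp add: s cf_def)
qed

text \<open>The expansion term depends on \<open>r\<close> only through the excised word once the
  pair is equal, so summing over the doubled letter contracts the first argument of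
  \<open>jw N r t\<close>.\<close>

lemma expansion_term_inner_left:
  assumes k: "k < a" and s: "s \<in> words N (Suc a)" and t: "t \<in> words N (Suc a)"
  shows "(\<Sum>r\<in>words N (Suc a). expansion_term c C b k s r * jw N r t) = 0"
proof -
  have "(\<Sum>r\<in>words N (Suc a). expansion_term c C b k s r * jw N r t) =
     (\<Sum>m\<in>words N b. \<Sum>s2\<in>words N c. \<Sum>t2\<in>words N c. C t2 s2 *
       (\<Sum>r\<in>words N (Suc a). of_bool (r ! k = r ! Suc k) *
         (jw N (tl s @ m @ s2) (hd s # excise k r @ m @ t2) * jw N r t)))"
  proof -
    have "expansion_term c C b k s r = (\<Sum>m\<in>words N b. \<Sum>s2\<in>words N c. \<Sum>t2\<in>words N c.
        C t2 s2 * (of_bool (r ! k = r ! Suc k) * jw N (tl s @ m @ s2) (hd s # excise k r @ m @ t2)))"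
      if "r \<in> words N (Suc a)" for r
      unfolding expansion_term_def using that k
      by (intro sum.cong refl) (simp add: nth_append length_words excise_left)
    then have "(\<Sum>r\<in>words N (Suc a). expansion_term c C b k s r * jw N r t) =
      (\<Sum>r\<in>words N (Suc a). \<Sum>m\<in>words N b. \<Sum>s2\<in>words N c. \<Sum>t2\<in>words N c. C t2 s2 *
       (of_bool (r ! k = r ! Suc k) *
         (jw N (tl s @ m @ s2) (hd s # excise k r @ m @ t2) * jw N r t)))"
      by (simp only: sum_distrib_right mult.assoc cong: sum.cong)
    then show ?thesis
      by (simp only: sum.swap[of _ "words N _" "words N (Suc a)"] sum_distrib_left)
  qed
  also have "\<dots> = 0"
  proof -
    have "(\<Sum>r\<in>words N (Suc a). of_bool (r ! k = r ! Suc k) * (g (excise k r) * jw N r t)) = 0" for g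
    proof -
      have "(\<Sum>r\<in>words N (Suc a). of_bool (r ! k = r ! Suc k) * (g (excise k r) * jw N r t)) =
        (\<Sum>u\<in>words N k. \<Sum>v\<in>words N (Suc a - k - 2). g (u @ v) * (\<Sum>l<N. jw N (u @ [l, l] @ v) t))"
        by (subst sum_words_pair) (use k in \<open>auto intro!: sum.cong simp: sum_distrib_left excise_def length_words\<close>)
      also have "\<dots> = 0"
      proof (intro sum.neutral ballI)
        fix u v assume "u \<in> words N k" "v \<in> words N (Suc a - k - 2)"
        then have "(\<Sum>l<N. jw N (u @ [l, l] @ v) t) = 0"
          by (rule harmonicD[OF harmonic_jw_left[OF N t]]) (use k in auto)
        then show "g (u @ v) * (\<Sum>l<N. jw N (u @ [l, l] @ v) t) = 0" by simp
      qed
      finally show ?thesis .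
    qed
    note vanish = this
    show ?thesis
    proof (intro sum.neutral ballI)
      fix m s2 t2
      show "C t2 s2 * (\<Sum>r\<in>words N (Suc a). of_bool (r ! k = r ! Suc k) *
          (jw N (tl s @ m @ s2) (hd s # excise k r @ m @ t2) * jw N r t)) = 0"
        by (subst vanish[of "\<lambda>e. jw N (tl s @ m @ s2) (hd s # e @ m @ t2)"]) simp
    qed
  qed
  finally show ?thesis .
qed

text \<open>The common letter of the pair leaves the column word, but as the first letter of the
  middle word it is still present in the row word, directly after \<open>tl s\<close>. There it
  joins the left leg, and the middle leg becomes one letter shorter.\<close>

lemma expansion_term_rotate:
  assumes s: "s \<in> words N (Suc a)" and t: "t \<in> words N (Suc a)"
  shows "expansion_term c C (Suc b) a s t = slice N c C b (tl s @ [last t]) (hd s # butlast t)"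
proof -
  obtain t' j where t': "t = t' @ [j]" "j < N" "length t' = a"
    using t by (cases t rule: rev_cases) (auto simp: words_def)
  have "expansion_term c C (Suc b) a s t = (\<Sum>i<N. if i = j then slice N c C b (tl s @ [j]) (hd s # t') else 0)"
    unfolding expansion_term_def sum_words_Suc slice_def
    using t' by (intro sum.cong refl) (auto simp: nth_append excise_def)
  then show ?thesis using t' by simp
qed

text \<open>The middle word occurs in both arguments. Excision removes the pair only from the column
  word, and the sum over the middle word then contracts it in the row word.\<close>

lemma expansion_term_middle:
  assumes k: "Suc a \<le> k" "k < a + b" and s: "s \<in> words N (Suc a)" and t: "t \<in> words N (Suc a)"
  shows "expansion_term c C b k s t = 0"
proof -
  obtain i s' where s': "s = i # s'" "i < N" "s' \<in> words N a"
    using s by (cases s) (auto simp: words_def)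
  define k' where "k' = k - Suc a"
  have kk: "k = length t + k'" "k' + 2 \<le> b"
    using k t by (auto simp: k'_def length_words)
  have "expansion_term c C b k s t = (\<Sum>m\<in>words N b. of_bool (m ! k' = m ! Suc k') *
     (\<Sum>s2\<in>words N c. \<Sum>t2\<in>words N c. C t2 s2 * jw N (s' @ m @ s2) (i # t @ excise k' m @ t2)))"
    unfolding expansion_term_def using kk
    by (intro sum.cong refl) (simp add: s' nth_append length_words excise_right excise_left sum_distrib_left mult.left_commute)
  also have "\<dots> = (\<Sum>u\<in>words N k'. \<Sum>v\<in>words N (b - k' - 2). \<Sum>l<N.
     \<Sum>s2\<in>words N c. \<Sum>t2\<in>words N c. C t2 s2 * jw N (s' @ (u @ [l, l] @ v) @ s2) (i # t @ u @ v @ t2))"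
    by (subst sum_words_pair) (use kk in \<open>auto intro!: sum.cong simp: excise_def length_words\<close>)
  also have "\<dots> = (\<Sum>u\<in>words N k'. \<Sum>v\<in>words N (b - k' - 2).
     \<Sum>s2\<in>words N c. \<Sum>t2\<in>words N c. C t2 s2 * (\<Sum>l<N. jw N (s' @ (u @ [l, l] @ v) @ s2) (i # t @ u @ v @ t2)))"
    by (simp only: sum.swap[of _ "words N c" "{..<N}"] sum_distrib_left)
  also have "\<dots> = 0"
  proof (intro sum.neutral ballI)
    fix u v s2 t2
    assume *: "u \<in> words N k'" "v \<in> words N (b - k' - 2)" "s2 \<in> words N c" "t2 \<in> words N c"
    have y: "i # t @ u @ v @ t2 \<in> words N (a + b + c)"
      using s' t * kk by (auto simp: words_def)
    have "(\<Sum>l<N. jw N ((s' @ u) @ [l, l] @ (v @ s2)) (i # t @ u @ v @ t2)) = 0"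
      by (rule harmonicD[OF harmonic_jw_left[OF N y], where k = "a + k'" and m = "b - k' - 2 + c"])
         (use s' * kk in \<open>auto simp: words_def\<close>)
    then show "C t2 s2 * (\<Sum>l<N. jw N (s' @ (u @ [l, l] @ v) @ s2) (i # t @ u @ v @ t2)) = 0"
      by simp
  qed
  finally show ?thesis .
qed

text \<open>Each entry is at most the mean of two diagonal entries, by \<open>jw_le_diag\<close>.
  One of them does not involve \<open>t2\<close> and the other does not involve \<open>s2\<close>,
  which gives the factor \<open>card (words N c)\<close>; the remaining sums are parts of traces.
  The condition b > 0 puts the pair entirely to the right of \<open>t\<close>.\<close>

lemma expansion_term_right:
  assumes k: "a + b \<le> k" "k < a + b + c" and s: "s \<in> words N (Suc a)" and t: "t \<in> words N (Suc a)"
    and C: "\<And>u v. \<bar>C u v\<bar> \<le> M" and b: "b > 0"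
  shows "\<bar>expansion_term c C b k s t\<bar> \<le> M * real N * real (card (words N c)) * qdim N (a + b + c)"
proof -
  obtain i s' where s': "s = i # s'" "i < N" "s' \<in> words N a"
    using s by (cases s) (auto simp: words_def)
  have M: "M \<ge> 0" using C[of undefined undefined] by linarith
  define K where "K = real (card (words N c))"
  define e where "e y = of_bool (y ! k = y ! Suc k) * jw N (i # excise k y) (i # excise k y)" for y
  define d where "d x = jw N x x" for x
  have bound: "\<bar>C t2 s2 * (of_bool ((t @ m @ t2) ! k = (t @ m @ t2) ! Suc k) *
       jw N (tl s @ m @ s2) (hd s # excise k (t @ m @ t2)))\<bar> \<le> M / 2 * (d (s' @ m @ s2) + e (t @ m @ t2))"
    if "m \<in> words N b" "s2 \<in> words N c" "t2 \<in> words N c" for m s2 t2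
  proof -
    define y where "y = t @ m @ t2"
    have x: "s' @ m @ s2 \<in> words N (a + (b + c))"
      using s' that by (intro append_in_words) auto
    have "excise k y \<in> words N (Suc a + (b + c) - 2)"
      unfolding y_def by (rule excise_words) (use t that k b in \<open>auto simp: words_def\<close>)
    then have y': "i # excise k y \<in> words N (a + (b + c))"
      using s'(2) Cons_in_words[of i "excise k y" N "a + b + c - 1"] b by (simp add: add.assoc)
    have "\<bar>of_bool (y ! k = y ! Suc k) * jw N (s' @ m @ s2) (i # excise k y)\<bar> \<le> (d (s' @ m @ s2) + e y) / 2"
      using jw_le_diag[OF N x y'] jw_diag_nonneg[OF N x] by (auto simp: d_def e_def)
    then have "\<bar>C t2 s2\<bar> * \<bar>of_bool (y ! k = y ! Suc k) * jw N (s' @ m @ s2) (i # excise k y)\<bar> \<le> M * ((d (s' @ m @ s2) + e y) / 2)"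
      by (intro mult_mono C M) auto
    then show ?thesis by (simp add: abs_mult s' y_def)
  qed
  have "\<bar>expansion_term c C b k s t\<bar> \<le>
     (\<Sum>m\<in>words N b. \<Sum>s2\<in>words N c. \<Sum>t2\<in>words N c. M / 2 * (d (s' @ m @ s2) + e (t @ m @ t2)))"
    unfolding expansion_term_def
    by (intro order_trans[OF sum_abs] sum_mono bound)
  also have "\<dots> = M / 2 * (K * (\<Sum>w\<in>words N (b + c). d (s' @ w)) + K * (\<Sum>w\<in>words N (b + c). e (t @ w)))"
    unfolding sum_words_add K_def
    by (simp add: sum.distrib sum_distrib_left distrib_left mult.left_commute)
  also have "\<dots> \<le> M / 2 * (K * qdim N (a + b + c) + K * (real N * qdim N (a + b + c)))"
  proof -
    have "(\<Sum>w\<in>words N (b + c). d (s' @ w)) \<le> qdim N (a + b + c)"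
      using diag_sum_le[OF s'(3), of "b + c"] by (simp add: d_def add.assoc)
    moreover have "(\<Sum>w\<in>words N (b + c). e (t @ w)) \<le> real N * qdim N (a + b + c)"
      using excised_diag_sum_le[OF t s'(2), of k "b + c"] k b by (simp add: e_def add.assoc)
    ultimately show ?thesis
      using M by (intro mult_left_mono add_mono) (auto simp: K_def)
  qed
  also have "\<dots> = M * K * qdim N (a + b + c) * ((1 + real N) / 2)"
    by (simp add: field_simps)
  also have "\<dots> \<le> M * K * qdim N (a + b + c) * real N"
    using N M less_imp_le[OF qdim_pos[OF N, of "a + b + c"]]
    by (intro mult_left_mono mult_nonneg_nonneg) (auto simp: K_def)
  finally show ?thesis by (simp only: K_def mult_ac)
qed

lemma slice_bounded:
  assumes C: "\<And>u v. \<bar>C u v\<bar> \<le> M"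
    and traceless: "(\<Sum>s2\<in>words N c. \<Sum>t2\<in>words N c. C t2 s2 * jw N s2 t2) = 0"
  shows "\<exists>D. \<forall>b. frob N a (slice N c C b) \<le> D"
proof (induction a)
  case 0
  \<comment> \<open>Tracing out the middle leg from the left gives a multiple of the kernel on the
    last c legs, where \<open>traceless\<close> applies.\<close>
  have "slice N c C b [] [] = 0" for b
  proof -
    have "slice N c C b [] [] = (\<Sum>s2\<in>words N c. \<Sum>t2\<in>words N c. C t2 s2 * (\<Sum>m\<in>words N b. jw N (m @ s2) (m @ t2)))"
      by (simp only: slice_def append_Nil sum.swap[of _ "words N c" "words N b"] sum_distrib_left)
    also have "\<dots> = (\<Sum>s2\<in>words N c. \<Sum>t2\<in>words N c. qdim N (b + c) / qdim N c * (C t2 s2 * jw N s2 t2))"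
      by (intro sum.cong refl) (simp add: jw_trace_left[OF N])
    also have "\<dots> = 0"
      unfolding sum_distrib_left[symmetric] traceless by simp
    finally show ?thesis .
  qed
  then show ?case by (auto simp: frob_eq)
next
  case (Suc a)
  then obtain D where D: "\<And>b. frob N a (slice N c C b) \<le> D" by blast
  have M: "M \<ge> 0" using C[of undefined undefined] by linarith
  \<comment> \<open>There are c remainder terms. Each has a coefficient of at most d_c / d_n and an
    expansion term of at most M N \<open>card (words N c)\<close> d_n; d_n cancels, so L is
    independent of b.\<close>
  define L where "L = real c * (qdim N c * (M * real N * real (card (words N c))))"
  define K where "K = sqrt (real N) * D + real (card (words N (Suc a) \<times> words N (Suc a))) * L"
  define F where "F b = frob N (Suc a) (slice N c C b)" for b
  have step: "F (Suc b) \<le> K + F b / 2" for b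
  proof -
    define n where "n = a + Suc b + c"
    define cf where "cf k = (-1) ^ Suc k * qdim N (n - 1 - k) / qdim N n" for k
    define X where "X s t = of_bool (hd t = hd s) * slice N c C (Suc b) (tl s) (tl t)" for s t
    define Y where "Y s t = slice N c C b (tl s @ [last t]) (hd s # butlast t)" for s t
    define Z where "Z s t = (\<Sum>k=a + Suc b..<n. cf k * expansion_term c C (Suc b) k s t)" for s t
    \<comment> \<open>\<open>X\<close> is the first summand of the recursion, \<open>Y\<close> the
      rotated slice from the pair at the border of the left leg, \<open>Z\<close> the pairs at the
      right end. Pairs inside the middle leg give zero, and those inside the left leg die under P_a,
      which \<open>frob_contraction\<close> then removes.\<close>
    have main: "slice N c C (Suc b) s t = (\<Sum>r\<in>words N (Suc a). (X s r + cf a * Y s r + Z s r) * jw N r t)"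
      if s: "s \<in> words N (Suc a)" and t: "t \<in> words N (Suc a)" for s t
    proof -
      have split: "(\<Sum>k<n. g k) = (\<Sum>k<a. g k) + (g a + (\<Sum>k=Suc a..<a + Suc b. g k) + (\<Sum>k=a + Suc b..<n. g k))"
        for g :: "nat \<Rightarrow> real"
        using sum.atLeastLessThan_concat[of 0 a n g] sum.atLeast_Suc_lessThan[of a n g]
          sum.atLeastLessThan_concat[of "Suc a" "a + Suc b" n g]
        by (simp add: lessThan_atLeast0 n_def)
      have "slice N c C (Suc b) s r = X s r + cf a * Y s r + Z s r
          + (\<Sum>k<a. cf k * expansion_term c C (Suc b) k s r)" if r: "r \<in> words N (Suc a)" for r
      proof -
        have "(\<Sum>k=Suc a..<a + Suc b. cf k * expansion_term c C (Suc b) k s r) = 0"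
          by (intro sum.neutral ballI) (simp add: expansion_term_middle[OF _ _ s r])
        then have "(\<Sum>k<n. cf k * expansion_term c C (Suc b) k s r) =
            (\<Sum>k<a. cf k * expansion_term c C (Suc b) k s r) + (cf a * Y s r + Z s r)"
          unfolding split Y_def Z_def expansion_term_rotate[OF s r] by simp
        then show ?thesis
          using slice_expand[OF s r, of c C "Suc b"] by (simp add: X_def cf_def n_def)
      qed
      then have "slice N c C (Suc b) s t = (\<Sum>r\<in>words N (Suc a).
          (X s r + cf a * Y s r + Z s r + (\<Sum>k<a. cf k * expansion_term c C (Suc b) k s r)) * jw N r t)"
        by (subst slice_absorb[OF s t, symmetric]) simp
      also have "\<dots> = (\<Sum>r\<in>words N (Suc a). (X s r + cf a * Y s r + Z s r) * jw N r t)
          + (\<Sum>k<a. cf k * (\<Sum>r\<in>words N (Suc a). expansion_term c C (Suc b) k s r * jw N r t))"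
        by (simp only: distrib_right sum.distrib sum_distrib_left sum_distrib_right mult.assoc
            sum.swap[of _ "words N (Suc a)" "{..<a}"])
      also have "(\<Sum>k<a. cf k * (\<Sum>r\<in>words N (Suc a). expansion_term c C (Suc b) k s r * jw N r t)) = 0"
        by (intro sum.neutral ballI) (simp add: expansion_term_inner_left[OF _ s t])
      finally show ?thesis by simp
    qed
    have "F (Suc b) = frob N (Suc a) (\<lambda>s t. \<Sum>r\<in>words N (Suc a). (X s r + cf a * Y s r + Z s r) * jw N r t)"
      unfolding F_def by (rule frob_cong) (rule main)
    also have "\<dots> \<le> frob N (Suc a) (\<lambda>s t. X s t + cf a * Y s t + Z s t)"
      by (rule frob_contraction)
    also have "\<dots> \<le> frob N (Suc a) X + \<bar>cf a\<bar> * frob N (Suc a) Y + frob N (Suc a) Z"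
      using frob_add[of N "Suc a" "\<lambda>s t. X s t + cf a * Y s t" Z]
        frob_add[of N "Suc a" X "\<lambda>s t. cf a * Y s t"] frob_scale[of N "Suc a" "cf a" Y] by linarith
    also have "frob N (Suc a) X \<le> sqrt (real N) * D"
      unfolding X_def frob_ampliate by (intro mult_left_mono D) simp
    also have "frob N (Suc a) Y = F b"
      unfolding Y_def F_def by (rule frob_rotate)
    \<comment> \<open>The coefficient is d_(b+c) / d_n up to sign, and n is at least b + c + 1, so
      one doubling suffices.\<close>
    also have "\<bar>cf a\<bar> * F b \<le> 1 / 2 * F b"
    proof (rule mult_right_mono)
      have "qdim N (b + c) * 2 \<le> qdim N (Suc (b + c))"
        using qdim_growth[OF N, of "b + c"] by simp
      also have "\<dots> \<le> qdim N n"
        by (rule qdim_mono[OF N]) (simp add: n_def)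
      finally show "\<bar>cf a\<bar> \<le> 1 / 2"
        using qdim_pos[OF N, of n] qdim_pos[OF N, of "b + c"]
        by (simp add: cf_def n_def abs_mult power_abs field_simps)
    qed (simp add: F_def frob_nonneg)
    also have "frob N (Suc a) Z \<le> real (card (words N (Suc a) \<times> words N (Suc a))) * L"
    proof (rule frob_le_of_entries)
      fix s t assume s: "s \<in> words N (Suc a)" and t: "t \<in> words N (Suc a)"
      have "\<bar>Z s t\<bar> \<le> (\<Sum>k=a + Suc b..<n. \<bar>cf k * expansion_term c C (Suc b) k s t\<bar>)"
        unfolding Z_def by (rule sum_abs)
      also have "\<dots> \<le> (\<Sum>k=a + Suc b..<n. qdim N c * (M * real N * real (card (words N c))))"
      proof (rule sum_mono)
        fix k assume k: "k \<in> {a + Suc b..<n}"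
        have "\<bar>expansion_term c C (Suc b) k s t\<bar> \<le> M * real N * real (card (words N c)) * qdim N n"
          unfolding n_def by (rule expansion_term_right) (use k s t C in \<open>auto simp: n_def\<close>)
        moreover have "\<bar>cf k\<bar> \<le> qdim N c / qdim N n"
        proof -
          have "qdim N (n - 1 - k) \<le> qdim N c"
            by (rule qdim_mono[OF N]) (use k in \<open>auto simp: n_def\<close>)
          then show ?thesis
            using qdim_pos[OF N, of n] qdim_pos[OF N, of "n - 1 - k"]
            by (simp add: cf_def abs_mult power_abs divide_right_mono del: qdim_pos)
        qed
        ultimately have "\<bar>cf k\<bar> * \<bar>expansion_term c C (Suc b) k s t\<bar> \<le>
            qdim N c / qdim N n * (M * real N * real (card (words N c)) * qdim N n)"
          using qdim_pos[OF N, of n] qdim_pos[OF N, of c] by (intro mult_mono) auto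
        then show "\<bar>cf k * expansion_term c C (Suc b) k s t\<bar> \<le> qdim N c * (M * real N * real (card (words N c)))"
          using qdim_pos[OF N, of n] by (simp add: abs_mult)
      qed
      also have "\<dots> = L" by (simp add: L_def n_def)
      finally show "\<bar>Z s t\<bar> \<le> L" .
    qed
    finally show ?thesis by (simp add: K_def)
  qed
  \<comment> \<open>2 K is the fixed point of x = K + x / 2; adding F 0 covers the start.\<close>
  have "F b \<le> F 0 + 2 * K" for b
  proof (induction b)
    case 0
    have "0 \<le> sqrt (real N) * D"
      using order_trans[OF frob_nonneg D] by simp
    moreover have "0 \<le> L"
      using M qdim_pos[OF N, of c] by (simp add: L_def)
    ultimately show ?case by (simp add: K_def)
  next
    case (Suc b)
    moreover have "0 \<le> F 0" by (simp add: F_def frob_nonneg)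
    ultimately show ?case using step[of b] by linarith
  qed
  then show ?case by (auto simp: F_def)
qed

text \<open>The matrix unit at (\<open>r\<close>, \<open>p\<close>) is corrected by a multiple of
  the identity. The choice of \<tau> makes the trace against P_c vanish, so
  \<open>slice_bounded\<close> applies to the difference. The identity part is computed exactly by
  \<open>jw_trace_right\<close> and is the main term.\<close>

lemma jw_factorization_1:
  assumes p: "p \<in> words N c" and r: "r \<in> words N c"
  shows "\<exists>D. \<forall>b. \<forall>s\<in>words N a. \<forall>t\<in>words N a.
    \<bar>(\<Sum>m\<in>words N b. jw N (s @ m @ p) (t @ m @ r))
      - qdim N (a + b + c) / (qdim N a * qdim N c) * jw N s t * jw N p r\<bar> \<le> D"
proof -
  define \<tau> where "\<tau> = jw N p r / qdim N c"
  define C where "C v u = of_bool (v = r \<and> u = p) - \<tau> * of_bool (v = u)" for v u :: "nat list"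
  have delta: "(\<Sum>s2\<in>words N c. \<Sum>t2\<in>words N c. C t2 s2 * g s2 t2) = g p r - \<tau> * (\<Sum>u\<in>words N c. g u u)"
    for g :: "nat list \<Rightarrow> nat list \<Rightarrow> real"
  proof -
    have "(\<Sum>s2\<in>words N c. \<Sum>t2\<in>words N c. C t2 s2 * g s2 t2) =
      (\<Sum>s2\<in>words N c. \<Sum>t2\<in>words N c. (if t2 = r then (if s2 = p then g p r else 0) else 0)
         - (if t2 = s2 then \<tau> * g s2 s2 else 0))"
      by (intro sum.cong refl) (auto simp: C_def algebra_simps)
    then show ?thesis using p r by (simp add: sum_subtractf sum_distrib_left)
  qed
  have "(\<Sum>s2\<in>words N c. \<Sum>t2\<in>words N c. C t2 s2 * jw N s2 t2) = 0"
    unfolding delta jw_trace[OF N] using qdim_nonzero[OF N, of c] by (simp add: \<tau>_def)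
  moreover have "\<bar>C u v\<bar> \<le> 1 + \<bar>\<tau>\<bar>" for u v
    by (auto simp: C_def)
  ultimately obtain D where D: "\<And>b. frob N a (slice N c C b) \<le> D"
    using slice_bounded by blast
  have "\<bar>(\<Sum>m\<in>words N b. jw N (s @ m @ p) (t @ m @ r))
      - qdim N (a + b + c) / (qdim N a * qdim N c) * jw N s t * jw N p r\<bar> \<le> D"
    if s: "s \<in> words N a" and t: "t \<in> words N a" for b s t
  proof -
    have "slice N c C b s t = (\<Sum>m\<in>words N b. jw N (s @ m @ p) (t @ m @ r))
        - \<tau> * (\<Sum>m\<in>words N b. \<Sum>u\<in>words N c. jw N (s @ m @ u) (t @ m @ u))"
      by (simp add: slice_def delta[of "\<lambda>s2 t2. jw N (s @ _ @ s2) (t @ _ @ t2)"] sum_subtractf sum_distrib_left)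
    also have "(\<Sum>m\<in>words N b. \<Sum>u\<in>words N c. jw N (s @ m @ u) (t @ m @ u)) =
        qdim N (a + b + c) / qdim N a * jw N s t"
      using jw_trace_right[OF N s t, of "b + c"] by (simp add: sum_words_add add_ac)
    finally have "slice N c C b s t = (\<Sum>m\<in>words N b. jw N (s @ m @ p) (t @ m @ r))
      - qdim N (a + b + c) / (qdim N a * qdim N c) * jw N s t * jw N p r"
      by (simp add: \<tau>_def mult_ac)
    then show ?thesis
      using frob_entry[OF s t, of "slice N c C b"] D[of b] by linarith
  qed
  then show ?thesis by blast
qed

lemma jw_factorization:
  "\<exists>D. \<forall>b. \<forall>s\<in>words N a. \<forall>t\<in>words N a. \<forall>p\<in>words N c. \<forall>r\<in>words N c.
    \<bar>(\<Sum>m\<in>words N b. jw N (s @ m @ p) (t @ m @ r))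
      - qdim N (a + b + c) / (qdim N a * qdim N c) * jw N s t * jw N p r\<bar> \<le> D"
proof -
  let ?d = "\<lambda>b s t p r. \<bar>(\<Sum>m\<in>words N b. jw N (s @ m @ p) (t @ m @ r))
      - qdim N (a + b + c) / (qdim N a * qdim N c) * jw N s t * jw N p r\<bar>"
  define D where "D p r = (SOME D. \<forall>b. \<forall>s\<in>words N a. \<forall>t\<in>words N a. ?d b s t p r \<le> D)" for p r
  have D: "?d b s t p r \<le> D p r"
    if "p \<in> words N c" "r \<in> words N c" "s \<in> words N a" "t \<in> words N a" for b s t p r
    using someI_ex[OF jw_factorization_1[OF that(1,2), of a]] that(3,4) unfolding D_def by blast
  \<comment> \<open>There are only finitely many p and r, so the sum of all constants serves every
    pair.\<close>
  have "?d b s t p r \<le> (\<Sum>p\<in>words N c. \<Sum>r\<in>words N c. \<bar>D p r\<bar>)"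
    if pr: "p \<in> words N c" "r \<in> words N c" and st: "s \<in> words N a" "t \<in> words N a" for b s t p r
  proof -
    have "?d b s t p r \<le> \<bar>D p r\<bar>"
      using D[OF pr st, of b] by linarith
    also have "\<dots> \<le> (\<Sum>r\<in>words N c. \<bar>D p r\<bar>)"
      by (rule member_le_sum) (use pr in auto)
    also have "\<dots> \<le> (\<Sum>p\<in>words N c. \<Sum>r\<in>words N c. \<bar>D p r\<bar>)"
      by (rule member_le_sum) (use pr in \<open>auto intro: sum_nonneg\<close>)
    finally show ?thesis .
  qed
  then show ?thesis by blast
qed

end

section \<open>From words to matrices\<close>

primrec encode :: "nat \<Rightarrow> nat list \<Rightarrow> nat" where
  "encode N [] = 0"
| "encode N (i # w) = i * N ^ length w + encode N w"

definition decode :: "nat \<Rightarrow> nat \<Rightarrow> nat \<Rightarrow> nat list" where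
  "decode N n = inv_into (words N n) (encode N)"

definition kernel_mat :: "nat \<Rightarrow> nat \<Rightarrow> (nat list \<Rightarrow> nat list \<Rightarrow> real) \<Rightarrow> complex mat" where
  "kernel_mat N n K =
     mat (N ^ n) (N ^ n) (\<lambda>(i, j). complex_of_real (K (decode N n i) (decode N n j)))"

lemma encode_append: "encode N (u @ v) = encode N u * N ^ length v + encode N v"
  by (induction u) (simp_all add: power_add algebra_simps)

lemma encode_append_words:
  "v \<in> words N n \<Longrightarrow> encode N (u @ v) = encode N u * N ^ n + encode N v"
  by (simp add: encode_append length_words)

lemma mult_add_less: "i < m \<Longrightarrow> k < r \<Longrightarrow> i * r + k < m * (r::nat)"
proof -
  assume "i < m" "k < r"
  then have "i * r + k < Suc i * r" by simp
  also have "\<dots> \<le> m * r" using \<open>i < m\<close> by (intro mult_le_mono1) simp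
  finally show ?thesis .
qed

lemma encode_less: "w \<in> words N n \<Longrightarrow> encode N w < N ^ n"
proof (induction n arbitrary: w)
  case (Suc n)
  then obtain i v where "w = i # v" "i < N" "v \<in> words N n"
    by (auto simp: words_Suc)
  with Suc.IH[of v] show ?case
    using mult_add_less[of i N "encode N v" "N ^ n"] by (simp add: length_words)
qed simp

text \<open>Surjectivity is division with remainder by \<open>N ^ n\<close>; injectivity then
  follows by counting.\<close>

lemma bij_encode: "bij_betw (encode N) (words N n) {..<N ^ n}"
proof -
  have "{..<N ^ n} \<subseteq> encode N ` words N n"
  proof (induction n)
    case (Suc n)
    show ?case
    proof
      fix k assume "k \<in> {..<N ^ Suc n}"
      then have k: "k < N ^ n * N" by (simp add: mult.commute)
      then have "k mod N ^ n \<in> {..<N ^ n}"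
        by (cases "N ^ n = 0") auto
      with Suc obtain w where w: "w \<in> words N n" "k mod N ^ n = encode N w" by blast
      have "k div N ^ n < N" using k by (simp add: less_mult_imp_div_less mult.commute)
      then have "k div N ^ n # w \<in> words N (Suc n)" using w by simp
      moreover have "encode N (k div N ^ n # w) = k"
        using w by (metis div_mult_mod_eq encode.simps(2) length_words)
      ultimately show "k \<in> encode N ` words N (Suc n)" by (metis image_eqI)
    qed
  qed auto
  moreover have "encode N ` words N n \<subseteq> {..<N ^ n}"
    using encode_less by auto
  ultimately have img: "encode N ` words N n = {..<N ^ n}" by blast
  have "card (words N n) \<le> N ^ n"
    using card_lists_length_eq[of "{..<N}" n] by (simp add: words_def conj_commute)
  then have "inj_on (encode N) (words N n)"
    by (intro eq_card_imp_inj_on) (use card_image_le[of "words N n" "encode N"] img in auto)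
  with img show ?thesis by (simp add: bij_betw_def)
qed

lemma encode_eq_iff: "u \<in> words N n \<Longrightarrow> v \<in> words N n \<Longrightarrow> encode N u = encode N v \<longleftrightarrow> u = v"
  using bij_encode by (auto simp: bij_betw_def inj_on_def)

lemma decode_encode: "w \<in> words N n \<Longrightarrow> decode N n (encode N w) = w"
  unfolding decode_def using bij_encode[of N n] by (intro inv_into_f_f) (auto simp: bij_betw_def)

lemma encodeE:
  assumes "k < N ^ n"
  obtains w where "w \<in> words N n" "k = encode N w"
  using assms bij_encode[of N n] by (auto simp: bij_betw_def)

lemma words_add_split:
  assumes "x \<in> words N (m + n)"
  obtains u v where "x = u @ v" "u \<in> words N m" "v \<in> words N n"
proof
  show "x = take m x @ drop m x" by simp
  show "take m x \<in> words N m" "drop m x \<in> words N n"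
    using assms set_take_subset[of m x] set_drop_subset[of m x] by (auto simp: words_def)
qed

lemma sum_encode: "(\<Sum>k<N ^ n. f k) = (\<Sum>w\<in>words N n. f (encode N w))"
  by (rule sum.reindex_bij_betw[OF bij_encode, symmetric])

lemma sum_words_2: "(\<Sum>w\<in>words N 2. f w) = (\<Sum>l<N. \<Sum>l'<N. f [l, l'])"
  by (simp add: numeral_2_eq_2 sum_words_Suc)

lemma kernel_mat_carrier [simp]: "kernel_mat N n K \<in> carrier_mat (N ^ n) (N ^ n)"
  by (simp add: kernel_mat_def)

lemma kernel_mat_dims [simp]: "dim_row (kernel_mat N n K) = N ^ n" "dim_col (kernel_mat N n K) = N ^ n"
  by (simp_all add: kernel_mat_def)

lemma kernel_mat_index:
  "x \<in> words N n \<Longrightarrow> y \<in> words N n \<Longrightarrow> kernel_mat N n K $$ (encode N x, encode N y) = complex_of_real (K x y)"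
  by (simp add: kernel_mat_def encode_less decode_encode)

lemma mat_eq_encodeI:
  assumes "A \<in> carrier_mat (N ^ m) (N ^ n)" "B \<in> carrier_mat (N ^ m) (N ^ n)"
    and "\<And>x y. x \<in> words N m \<Longrightarrow> y \<in> words N n \<Longrightarrow> A $$ (encode N x, encode N y) = B $$ (encode N x, encode N y)"
  shows "A = B"
proof (rule eq_matI)
  fix i j assume "i < dim_row B" "j < dim_col B"
  with assms show "A $$ (i, j) = B $$ (i, j)"
    by (metis carrier_matD encodeE)
qed (use assms in auto)

lemma index_mult_mat_encode:
  assumes "A \<in> carrier_mat r (N ^ n)" "B \<in> carrier_mat (N ^ n) c" "i < r" "j < c"
  shows "(A * B) $$ (i, j) = (\<Sum>y\<in>words N n. A $$ (i, encode N y) * B $$ (encode N y, j))"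
  using assms by (simp add: scalar_prod_def atLeast0LessThan encode_less sum_encode)

lemma index_mult_vec_encode:
  assumes "A \<in> carrier_mat r (N ^ n)" "v \<in> carrier_vec (N ^ n)" "i < r"
  shows "(A *\<^sub>v v) $ i = (\<Sum>y\<in>words N n. A $$ (i, encode N y) * v $ encode N y)"
  using assms by (simp add: scalar_prod_def atLeast0LessThan encode_less sum_encode)

lemma kron_mat_dims [simp]:
  "dim_row (kron_mat A B) = dim_row A * dim_row B" "dim_col (kron_mat A B) = dim_col A * dim_col B"
  by (simp_all add: kron_mat_def)

lemma kron_mat_carrier:
  "A \<in> carrier_mat m n \<Longrightarrow> B \<in> carrier_mat m' n' \<Longrightarrow> kron_mat A B \<in> carrier_mat (m * m') (n * n')"
  by auto

lemma kron_mat_index: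
  assumes "A \<in> carrier_mat m n" "B \<in> carrier_mat m' n'" "i < m" "j < n" "i' < m'" "j' < n'"
  shows "kron_mat A B $$ (i * m' + i', j * n' + j') = A $$ (i, j) * B $$ (i', j')"
  using assms by (auto simp: kron_mat_def mult_add_less)

section \<open>Contractions of neighbouring factors and membership in \<open>H\<close>\<close>

lemma t1_dims: "t1 N \<in> carrier_mat (N * N) 1"
  by (simp add: t1_def)

lemma t1_index:
  assumes "a < N" "b < N"
  shows "t1 N $$ (a * N + b, 0) = of_bool (a = b)"
proof -
  have "a * N + b < N * N" using assms by (rule mult_add_less)
  then have "t1 N $$ (a * N + b, 0) = (\<Sum>i<N. kron_vec (unit_vec N i) (unit_vec N i) $ (a * N + b))"
    by (simp add: t1_def)
  also have "\<dots> = (\<Sum>i<N. if i = a then of_bool (a = b) else 0)"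
    using assms \<open>a * N + b < N * N\<close> by (intro sum.cong refl) (auto simp: kron_vec_def unit_vec_def)
  also have "\<dots> = of_bool (a = b)" using assms by simp
  finally show ?thesis .
qed

lemma adjoint_t1_index:
  assumes "a < N" "b < N"
  shows "mat_adjoint (t1 N) $$ (0, a * N + b) = of_bool (a = b)"
proof -
  have *: "a * N + b < N * N" using assms by (rule mult_add_less)
  have "mat_adjoint (t1 N) $$ (0, a * N + b) = conjugate (t1 N $$ (a * N + b, 0))"
    using * t1_dims[of N] by (simp add: mat_adjoint_def mat_of_rows_def cols_def)
  then show ?thesis using t1_index[OF assms] by simp
qed

lemma adjoint_t1_carrier: "mat_adjoint (t1 N) \<in> carrier_mat 1 (N * N)"
  using t1_dims[of N] by (intro carrier_matI) (simp_all add: mat_adjoint_def mat_of_rows_def)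

text \<open>The matrix occurring in \<open>H\<close>, with the number m of factors to the right as a
  parameter in place of \<open>n - i - 2\<close>.\<close>

definition contraction :: "nat \<Rightarrow> nat \<Rightarrow> nat \<Rightarrow> complex mat" where
  "contraction N i m = kron_mat (kron_mat (1\<^sub>m (N ^ i)) (mat_adjoint (t1 N))) (1\<^sub>m (N ^ m))"

lemma contraction_carrier: "contraction N i m \<in> carrier_mat (N ^ (i + m)) (N ^ (i + 2 + m))"
  using kron_mat_carrier[OF kron_mat_carrier[OF one_carrier_mat[of "N ^ i"] adjoint_t1_carrier] one_carrier_mat[of "N ^ m"], of N]
  by (simp add: contraction_def power_add power2_eq_square mult_ac)

lemma contraction_index:
  assumes v: "v \<in> carrier_vec (N ^ (i + 2 + m))" and u: "u \<in> words N i" and w: "w \<in> words N m"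
  shows "(contraction N i m *\<^sub>v v) $ encode N (u @ w) = (\<Sum>l<N. v $ encode N (u @ [l, l] @ w))"
proof -
  have entry: "contraction N i m $$ (encode N (u @ w), encode N (u' @ [l, l'] @ w')) =
      (if u' = u then if w' = w then of_bool (l = l') else 0 else 0)"
    if *: "u' \<in> words N i" "w' \<in> words N m" "l < N" "l' < N" for u' w' l l'
  proof -
    have k: "kron_mat (1\<^sub>m (N ^ i)) (mat_adjoint (t1 N)) \<in> carrier_mat (N ^ i * 1) (N ^ i * (N * N))"
      by (intro kron_mat_carrier adjoint_t1_carrier) simp
    have ll: "l * N + l' < N * N" using * by (intro mult_add_less)
    have e: "encode N (u' @ [l, l'] @ w') = (encode N u' * (N * N) + (l * N + l')) * N ^ m + encode N w'"
      using * by (simp add: encode_append length_words algebra_simps)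
    have e': "encode N (u @ w) = (encode N u * 1 + 0) * N ^ m + encode N w"
      using w by (simp add: encode_append_words)
    have "contraction N i m $$ (encode N (u @ w), encode N (u' @ [l, l'] @ w')) =
       kron_mat (1\<^sub>m (N ^ i)) (mat_adjoint (t1 N)) $$ (encode N u * 1 + 0, encode N u' * (N * N) + (l * N + l'))
         * 1\<^sub>m (N ^ m) $$ (encode N w, encode N w')"
      unfolding contraction_def e e'
      by (rule kron_mat_index[OF k]) (use u w * ll in \<open>auto simp: encode_less intro: mult_add_less\<close>)
    also have "kron_mat (1\<^sub>m (N ^ i)) (mat_adjoint (t1 N)) $$ (encode N u * 1 + 0, encode N u' * (N * N) + (l * N + l'))
        = 1\<^sub>m (N ^ i) $$ (encode N u, encode N u') * mat_adjoint (t1 N) $$ (0, l * N + l')"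
      by (rule kron_mat_index[OF _ adjoint_t1_carrier]) (use u * ll in \<open>auto simp: encode_less\<close>)
    finally show ?thesis
      using u w * by (auto simp: adjoint_t1_index encode_less encode_eq_iff)
  qed
  have "(contraction N i m *\<^sub>v v) $ encode N (u @ w) =
      (\<Sum>y\<in>words N (i + 2 + m). contraction N i m $$ (encode N (u @ w), encode N y) * v $ encode N y)"
    by (rule index_mult_vec_encode[OF contraction_carrier v])
       (use u w in \<open>auto intro: encode_less append_in_words\<close>)
  also have "\<dots> = (\<Sum>u'\<in>words N i. \<Sum>l<N. \<Sum>l'<N. \<Sum>w'\<in>words N m.
      contraction N i m $$ (encode N (u @ w), encode N (u' @ [l, l'] @ w')) * v $ encode N (u' @ [l, l'] @ w'))"
    by (simp only: sum_words_add sum_words_2 append_assoc)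
  also have "\<dots> = (\<Sum>u'\<in>words N i. \<Sum>l<N. if u' = u then v $ encode N (u @ [l, l] @ w) else 0)"
  proof (intro sum.cong refl)
    fix u' l assume *: "u' \<in> words N i" "l \<in> {..<N}"
    have "(\<Sum>l'<N. \<Sum>w'\<in>words N m.
        contraction N i m $$ (encode N (u @ w), encode N (u' @ [l, l'] @ w')) * v $ encode N (u' @ [l, l'] @ w')) =
      (\<Sum>l'<N. \<Sum>w'\<in>words N m. if w' = w then if l' = l then
         if u' = u then v $ encode N (u @ [l, l] @ w) else 0 else 0 else 0)"
      by (intro sum.cong refl, subst entry) (use * in auto)
    with * w show "(\<Sum>l'<N. \<Sum>w'\<in>words N m.
        contraction N i m $$ (encode N (u @ w), encode N (u' @ [l, l'] @ w')) * v $ encode N (u' @ [l, l'] @ w')) =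
      (if u' = u then v $ encode N (u @ [l, l] @ w) else 0)"
      by simp
  qed
  also have "\<dots> = (\<Sum>u'\<in>words N i. if u' = u then \<Sum>l<N. v $ encode N (u @ [l, l] @ w) else 0)"
    by (intro sum.cong refl) simp
  also have "\<dots> = (\<Sum>l<N. v $ encode N (u @ [l, l] @ w))"
    using u by simp
  finally show ?thesis .
qed

lemma mem_H_iff:
  assumes v: "v \<in> carrier_vec (N ^ n)"
  shows "v \<in> H N n \<longleftrightarrow> (\<forall>i m. \<forall>u\<in>words N i. \<forall>w\<in>words N m. i + 2 + m = n \<longrightarrow>
     (\<Sum>l<N. v $ encode N (u @ [l, l] @ w)) = 0)"
proof -
  have "contraction N i m *\<^sub>v v = 0\<^sub>v (N ^ (n - 2)) \<longleftrightarrow>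
      (\<forall>u\<in>words N i. \<forall>w\<in>words N m. (\<Sum>l<N. v $ encode N (u @ [l, l] @ w)) = 0)"
    if n: "i + 2 + m = n" for i m
  proof -
    have nim: "n - 2 = i + m" using n by simp
    have v': "v \<in> carrier_vec (N ^ (i + 2 + m))" using v n by simp
    have dim: "dim_vec (contraction N i m *\<^sub>v v) = N ^ (i + m)"
      using contraction_carrier[of N i m] by simp
    have "contraction N i m *\<^sub>v v = 0\<^sub>v (N ^ (n - 2)) \<longleftrightarrow>
        (\<forall>k<N ^ (i + m). (contraction N i m *\<^sub>v v) $ k = 0)"
      unfolding nim vec_eq_iff dim by simp
    also have "\<dots> \<longleftrightarrow> (\<forall>x\<in>words N (i + m). (contraction N i m *\<^sub>v v) $ encode N x = 0)"
      by (metis encodeE encode_less)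
    also have "\<dots> \<longleftrightarrow> (\<forall>u\<in>words N i. \<forall>w\<in>words N m. (contraction N i m *\<^sub>v v) $ encode N (u @ w) = 0)"
    proof (intro iffI ballI)
      fix x assume x: "x \<in> words N (i + m)"
        and *: "\<forall>u\<in>words N i. \<forall>w\<in>words N m. (contraction N i m *\<^sub>v v) $ encode N (u @ w) = 0"
      have "take i x \<in> words N i" "drop i x \<in> words N m"
        using x set_take_subset[of i x] set_drop_subset[of i x] by (auto simp: words_def)
      with * have "(contraction N i m *\<^sub>v v) $ encode N (take i x @ drop i x) = 0" by blast
      then show "(contraction N i m *\<^sub>v v) $ encode N x = 0" by simp
    qed (auto intro: append_in_words)
    finally show ?thesis using contraction_index[OF v'] by simp
  qed
  note eq = this
  have "v \<in> H N n \<longleftrightarrow> (\<forall>i. i + 2 \<le> n \<longrightarrow> contraction N i (n - i - 2) *\<^sub>v v = 0\<^sub>v (N ^ (n - 2)))"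
    using v by (simp add: H_def contraction_def)
  also have "\<dots> \<longleftrightarrow> (\<forall>i m. i + 2 + m = n \<longrightarrow> contraction N i m *\<^sub>v v = 0\<^sub>v (N ^ (n - 2)))"
  proof (intro iffI allI impI)
    fix i m assume *: "\<forall>i. i + 2 \<le> n \<longrightarrow> contraction N i (n - i - 2) *\<^sub>v v = 0\<^sub>v (N ^ (n - 2))" "i + 2 + m = n"
    then have "m = n - i - 2" "i + 2 \<le> n" by auto
    with * show "contraction N i m *\<^sub>v v = 0\<^sub>v (N ^ (n - 2))" by simp
  qed auto
  also have "\<dots> \<longleftrightarrow> (\<forall>i m. \<forall>u\<in>words N i. \<forall>w\<in>words N m. i + 2 + m = n \<longrightarrow>
     (\<Sum>l<N. v $ encode N (u @ [l, l] @ w)) = 0)"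
    using eq by blast
  finally show ?thesis .
qed

text \<open>For the uniqueness demanded by \<open>THE\<close>: two candidate images of v differ by a
  vector of the form y - x that is orthogonal to W, in particular to x and y, hence to
  itself.\<close>

lemma orth_proj_eqI:
  assumes P: "P \<in> carrier_mat n n" and W: "W \<subseteq> carrier_vec n"
    and proj: "\<And>v. v \<in> carrier_vec n \<Longrightarrow> P *\<^sub>v v \<in> W"
    and orth: "\<And>v w. v \<in> carrier_vec n \<Longrightarrow> w \<in> W \<Longrightarrow> (v - P *\<^sub>v v) \<bullet>c w = 0"
  shows "orth_proj n W = P"
  unfolding orth_proj_def
proof (rule the_equality)
  show "P \<in> carrier_mat n n \<and> (\<forall>v\<in>carrier_vec n. P *\<^sub>v v \<in> W \<and> (\<forall>w\<in>W. (v - P *\<^sub>v v) \<bullet>c w = 0))"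
    using assms by auto
next
  fix Q assume Q: "Q \<in> carrier_mat n n \<and> (\<forall>v\<in>carrier_vec n. Q *\<^sub>v v \<in> W \<and> (\<forall>w\<in>W. (v - Q *\<^sub>v v) \<bullet>c w = 0))"
  have "Q *\<^sub>v v = P *\<^sub>v v" if v: "v \<in> carrier_vec n" for v
  proof -
    define x y where "x = P *\<^sub>v v" and "y = Q *\<^sub>v v"
    have x: "x \<in> carrier_vec n" "x \<in> W" and y: "y \<in> carrier_vec n" "y \<in> W"
      using P Q v proj by (auto simp: x_def y_def)
    have ip: "a \<bullet>c b = (\<Sum>i<n. a $ i * cnj (b $ i))" if "a \<in> carrier_vec n" "b \<in> carrier_vec n" for a b :: "complex vec"
      using that by (simp add: scalar_prod_def atLeast0LessThan)
    have "(y - x) \<bullet>c w = 0" if "w \<in> W" for w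
    proof -
      have w: "w \<in> carrier_vec n" using that W by auto
      have "(v - x) \<bullet>c w = 0" "(v - y) \<bullet>c w = 0"
        using orth Q v that by (auto simp: x_def y_def)
      then show ?thesis
        using v w x(1) y(1) by (simp add: ip algebra_simps sum_subtractf)
    qed
    from this[OF x(2)] this[OF y(2)] have "(y - x) \<bullet>c (y - x) = 0"
      using x(1) y(1) by (simp add: ip algebra_simps sum_subtractf)
    then have "y - x = 0\<^sub>v n"
      using x(1) y(1) by (subst (asm) conjugate_square_eq_0_vec) auto
    then have "y $ i = x $ i" if "i < n" for i
      using that x(1) y(1) by (metis carrier_vecD eq_iff_diff_eq_0 index_minus_vec(1) index_zero_vec(1))
    moreover have "dim_vec x = n" "dim_vec y = n" using x(1) y(1) by auto
    ultimately have "y = x" by (intro eq_vecI) auto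
    then show ?thesis by (simp add: x_def y_def)
  qed
  note eq = this
  have entry: "(A *\<^sub>v unit_vec n j) $ i = A $$ (i, j)"
    if "A \<in> carrier_mat n n" "i < n" "j < n" for A :: "complex mat" and i j
    using that by simp
  have "Q $$ (i, j) = P $$ (i, j)" if "i < n" "j < n" for i j
    using entry[OF conjunct1[OF Q] that] entry[OF P that] eq[OF unit_vec_carrier[of n j]] by simp
  then show "Q = P"
    using P Q by (intro eq_matI) auto
qed

section \<open>The Jones-Wenzl matrices and their tensor products\<close>

context
  fixes N :: nat
  assumes N: "N > 2"
begin

text \<open>The kernel is real, so real and imaginary parts are reproduced separately.\<close>

lemma jw_reproduces_complex:
  fixes f :: "nat list \<Rightarrow> complex"
  assumes "\<And>i m u w. u \<in> words N i \<Longrightarrow> w \<in> words N m \<Longrightarrow> i + 2 + m = n \<Longrightarrow> (\<Sum>l<N. f (u @ [l, l] @ w)) = 0"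
    and x: "x \<in> words N n"
  shows "(\<Sum>y\<in>words N n. complex_of_real (jw N x y) * f y) = f x"
proof -
  have zero: "(\<Sum>l<N. f (u @ [l, l] @ w)) = 0"
    if "length u + length w + 2 = n" "set u \<subseteq> {..<N}" "set w \<subseteq> {..<N}" for u w
    by (rule assms(1)[of u "length u" w "length w"]) (use that in \<open>auto simp: words_def\<close>)
  have "harmonic N n (\<lambda>y. Re (f y))" "harmonic N n (\<lambda>y. Im (f y))"
    unfolding harmonic_def Re_sum[symmetric] Im_sum[symmetric] using zero by auto
  then show ?thesis
    using jw_reproduces[OF N _ x] by (intro complex_eqI) simp_all
qed

lemma jw_mat_apply:
  assumes "v \<in> carrier_vec (N ^ n)" "x \<in> words N n"
  shows "(kernel_mat N n (jw N) *\<^sub>v v) $ encode N x = (\<Sum>y\<in>words N n. complex_of_real (jw N x y) * v $ encode N y)"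
  using assms by (subst index_mult_vec_encode[where r = "N ^ n"]) (auto simp: encode_less kernel_mat_index)

lemma jw_mat_range:
  assumes v: "v \<in> carrier_vec (N ^ n)"
  shows "kernel_mat N n (jw N) *\<^sub>v v \<in> H N n"
proof -
  let ?P = "kernel_mat N n (jw N)"
  have Pv: "?P *\<^sub>v v \<in> carrier_vec (N ^ n)"
    using v by (rule mult_mat_vec_carrier[OF kernel_mat_carrier])
  show ?thesis
    unfolding mem_H_iff[OF Pv]
  proof (intro allI ballI impI)
    fix i m u w assume *: "u \<in> words N i" "w \<in> words N m" "i + 2 + m = n"
    have mem: "u @ [l, l] @ w \<in> words N n" if "l < N" for l
      using * that by (auto simp: words_def)
    have "(\<Sum>l<N. (?P *\<^sub>v v) $ encode N (u @ [l, l] @ w)) =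
        (\<Sum>l<N. \<Sum>y\<in>words N n. complex_of_real (jw N (u @ [l, l] @ w) y) * v $ encode N y)"
      by (intro sum.cong refl jw_mat_apply[OF v] mem) simp
    also have "\<dots> = (\<Sum>y\<in>words N n. complex_of_real (\<Sum>l<N. jw N (u @ [l, l] @ w) y) * v $ encode N y)"
      by (subst sum.swap) (simp only: sum_distrib_right of_real_sum)
    also have "\<dots> = 0"
    proof (intro sum.neutral ballI)
      fix y assume "y \<in> words N n"
      then have "(\<Sum>l<N. jw N (u @ [l, l] @ w) y) = 0"
        by (rule harmonicD[OF harmonic_jw_left[OF N] *(1,2)]) (use * in simp)
      then show "complex_of_real (\<Sum>l<N. jw N (u @ [l, l] @ w) y) * v $ encode N y = 0" by simp
    qed
    finally show "(\<Sum>l<N. (?P *\<^sub>v v) $ encode N (u @ [l, l] @ w)) = 0" .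
  qed
qed

lemma jw_mat_fixes:
  assumes w: "w \<in> H N n" and y: "y \<in> words N n"
  shows "(\<Sum>x\<in>words N n. complex_of_real (jw N y x) * w $ encode N x) = w $ encode N y"
proof (rule jw_reproduces_complex[OF _ y])
  have "w \<in> carrier_vec (N ^ n)" using w by (auto simp: H_def)
  from mem_H_iff[OF this] w
  show "(\<Sum>l<N. w $ encode N (u @ [l, l] @ v)) = 0"
    if "u \<in> words N i" "v \<in> words N m" "i + 2 + m = n" for i m u v
    using that by blast
qed

text \<open>Orthogonality: a real symmetric kernel may be moved to the other side of the inner
  product, where it fixes w.\<close>

lemma JW_eq: "JW N n = kernel_mat N n (jw N)"
  unfolding JW_def
proof (rule orth_proj_eqI)
  let ?P = "kernel_mat N n (jw N)"
  show H: "H N n \<subseteq> carrier_vec (N ^ n)" by (auto simp: H_def)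
  fix v :: "complex vec" assume v: "v \<in> carrier_vec (N ^ n)"
  show "?P *\<^sub>v v \<in> H N n" by (rule jw_mat_range[OF v])
  then have Pv: "?P *\<^sub>v v \<in> carrier_vec (N ^ n)" using H by blast
  fix w assume w: "w \<in> H N n"
  then have w': "w \<in> carrier_vec (N ^ n)" using H by auto
  have ip: "a \<bullet>c w = (\<Sum>x\<in>words N n. a $ encode N x * cnj (w $ encode N x))" if "a \<in> carrier_vec (N ^ n)" for a
    using that w' by (simp add: scalar_prod_def atLeast0LessThan sum_encode encode_less)
  have "(?P *\<^sub>v v) \<bullet>c w =
      (\<Sum>x\<in>words N n. \<Sum>y\<in>words N n. complex_of_real (jw N x y) * v $ encode N y * cnj (w $ encode N x))"
    unfolding ip[OF Pv] by (intro sum.cong refl) (simp add: jw_mat_apply[OF v] sum_distrib_right)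
  also have "\<dots> = (\<Sum>y\<in>words N n. \<Sum>x\<in>words N n. complex_of_real (jw N x y) * v $ encode N y * cnj (w $ encode N x))"
    by (rule sum.swap)
  also have "\<dots> = (\<Sum>y\<in>words N n. v $ encode N y * cnj (\<Sum>x\<in>words N n. complex_of_real (jw N y x) * w $ encode N x))"
    unfolding cnj_sum sum_distrib_left using jw_sym[OF N] by (intro sum.cong refl) simp
  also have "\<dots> = (\<Sum>y\<in>words N n. v $ encode N y * cnj (w $ encode N y))"
    using jw_mat_fixes[OF w] by simp
  also have "\<dots> = v \<bullet>c w" using ip[OF v] by simp
  finally show "(v - ?P *\<^sub>v v) \<bullet>c w = 0"
    using v Pv w' by (simp add: minus_scalar_prod_distrib[of _ "N ^ n"])
qed simp

lemma JW_index:
  "x \<in> words N n \<Longrightarrow> y \<in> words N n \<Longrightarrow> JW N n $$ (encode N x, encode N y) = complex_of_real (jw N x y)"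
  by (simp add: JW_eq kernel_mat_index)

lemma JW_carrier: "JW N n \<in> carrier_mat (N ^ n) (N ^ n)"
  by (simp add: JW_eq)

lemma JW_dims [simp]: "dim_row (JW N n) = N ^ n" "dim_col (JW N n) = N ^ n"
  by (simp_all add: JW_eq)

lemma JW_idem: "JW N n * JW N n = JW N n"
proof (rule mat_eq_encodeI)
  fix x y assume x: "x \<in> words N n" and y: "y \<in> words N n"
  have "(JW N n * JW N n) $$ (encode N x, encode N y) =
      complex_of_real (\<Sum>w\<in>words N n. jw N x w * jw N y w)"
    using x y jw_sym[OF N _ y]
    by (subst index_mult_mat_encode[OF JW_carrier JW_carrier]) (simp_all add: encode_less JW_index)
  also have "\<dots> = JW N n $$ (encode N x, encode N y)"
    using x y by (simp add: jw_gram[OF N x y] jw_sym[OF N y x] JW_index)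
  finally show "(JW N n * JW N n) $$ (encode N x, encode N y) = JW N n $$ (encode N x, encode N y)" .
qed (rule mult_carrier_mat[OF JW_carrier JW_carrier] JW_carrier)+

lemma JW_range: "v \<in> carrier_vec (N ^ n) \<Longrightarrow> JW N n *\<^sub>v v \<in> H N n"
  unfolding JW_eq by (rule jw_mat_range)

lemma JW_fixes:
  assumes "v \<in> H N n"
  shows "JW N n *\<^sub>v v = v"
proof (rule eq_vecI)
  have v: "v \<in> carrier_vec (N ^ n)" using assms by (auto simp: H_def)
  then show dim: "dim_vec (JW N n *\<^sub>v v) = dim_vec v" by simp
  fix k assume "k < dim_vec v"
  with v obtain x where "x \<in> words N n" "k = encode N x"
    using encodeE[of k N n] by auto
  then show "(JW N n *\<^sub>v v) $ k = v $ k"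
    using jw_mat_apply[OF v] jw_mat_fixes[OF assms] by (simp add: JW_eq)
qed

lemma H_eq_range: "H N n = {JW N n *\<^sub>v v | v. v \<in> carrier_vec (N ^ n)}"
proof (intro equalityI subsetI)
  fix v assume v: "v \<in> H N n"
  then have "v \<in> carrier_vec (N ^ n)" by (auto simp: H_def)
  with JW_fixes[OF v] show "v \<in> {JW N n *\<^sub>v v | v. v \<in> carrier_vec (N ^ n)}"
    by (intro CollectI exI[of _ v]) simp
qed (auto intro: JW_range)

definition product_proj where
  "product_proj a c = kron_mat (JW N a) (JW N c)"

lemma product_proj_carrier: "product_proj a c \<in> carrier_mat (N ^ (a + c)) (N ^ (a + c))"
  using kron_mat_carrier[OF JW_carrier JW_carrier] by (simp add: product_proj_def power_add)

lemma product_proj_index: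
  assumes "x \<in> words N a" "y \<in> words N a" "x' \<in> words N c" "y' \<in> words N c"
  shows "product_proj a c $$ (encode N (x @ x'), encode N (y @ y')) = complex_of_real (jw N x y * jw N x' y')"
  using assms kron_mat_index[OF JW_carrier[of a] JW_carrier[of c], of "encode N x" "encode N y" "encode N x'" "encode N y'"]
  by (simp add: product_proj_def encode_append_words encode_less JW_index)

definition triple_proj where
  "triple_proj a b c = kron_mat (kron_mat (JW N a) (JW N b)) (JW N c)"

lemma triple_proj_carrier: "triple_proj a b c \<in> carrier_mat (N ^ (a + b + c)) (N ^ (a + b + c))"
  using kron_mat_carrier[OF product_proj_carrier JW_carrier]
  by (simp add: triple_proj_def product_proj_def power_add)

lemma triple_proj_index:
  assumes "x \<in> words N a" "y \<in> words N a" "x' \<in> words N b" "y' \<in> words N b" "x'' \<in> words N c" "y'' \<in> words N c"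
  shows "triple_proj a b c $$ (encode N (x @ x' @ x''), encode N (y @ y' @ y'')) =
    complex_of_real (jw N x y * jw N x' y' * jw N x'' y'')"
  using assms product_proj_index[OF assms(1-4)]
    kron_mat_index[OF product_proj_carrier[of a b] JW_carrier[of c],
      of "encode N (x @ x')" "encode N (y @ y')" "encode N x''" "encode N y''"]
  by (simp add: triple_proj_def product_proj_def encode_append_words[of x''] encode_append_words[of y'']
      encode_less append_in_words JW_index flip: append_assoc)

text \<open>With all other letters held fixed, a column of the kernel is harmonic in each block of
  letters. The three factors are thus absorbed one by one, starting from the right.\<close>

lemma triple_proj_absorb_left: "triple_proj a b c * JW N (a + b + c) = JW N (a + b + c)"
proof (rule mat_eq_encodeI)
  fix x y assume x: "x \<in> words N (a + b + c)" and y: "y \<in> words N (a + b + c)"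
  obtain r x3 where "x = r @ x3" "r \<in> words N (a + b)" and x3: "x3 \<in> words N c"
    using words_add_split[OF x] .
  moreover obtain x1 x2 where "r = x1 @ x2" and x12: "x1 \<in> words N a" "x2 \<in> words N b"
    using words_add_split[OF \<open>r \<in> words N (a + b)\<close>] .
  ultimately have x': "x = x1 @ x2 @ x3" by simp
  have harm: "harmonic N (a + b + c) (\<lambda>z. jw N z y)" by (rule harmonic_jw_left[OF N y])
  have "(triple_proj a b c * JW N (a + b + c)) $$ (encode N x, encode N y) =
      (\<Sum>z1\<in>words N a. \<Sum>z2\<in>words N b. \<Sum>z3\<in>words N c.
        triple_proj a b c $$ (encode N x, encode N (z1 @ z2 @ z3)) * JW N (a + b + c) $$ (encode N (z1 @ z2 @ z3), encode N y))"
    using x y by (simp add: index_mult_mat_encode[OF triple_proj_carrier JW_carrier] encode_less sum_words_add)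
  also have "\<dots> = (\<Sum>z1\<in>words N a. \<Sum>z2\<in>words N b. \<Sum>z3\<in>words N c. complex_of_real
        (jw N x1 z1 * (jw N x2 z2 * (jw N x3 z3 * jw N (z1 @ z2 @ z3) y))))"
    unfolding x' using x12 x3 y
    by (intro sum.cong refl) (subst triple_proj_index, auto simp: append_in_words add.assoc JW_index)
  also have "\<dots> = complex_of_real (\<Sum>z1\<in>words N a. jw N x1 z1 * (\<Sum>z2\<in>words N b. jw N x2 z2 *
        (\<Sum>z3\<in>words N c. jw N x3 z3 * jw N (z1 @ z2 @ z3) y)))"
    by (simp only: of_real_sum of_real_mult sum_distrib_left)
  also have "(\<Sum>z1\<in>words N a. jw N x1 z1 * (\<Sum>z2\<in>words N b. jw N x2 z2 *
        (\<Sum>z3\<in>words N c. jw N x3 z3 * jw N (z1 @ z2 @ z3) y))) =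
      (\<Sum>z1\<in>words N a. jw N x1 z1 * (\<Sum>z2\<in>words N b. jw N x2 z2 * jw N (z1 @ z2 @ x3) y))"
  proof (intro sum.cong refl arg_cong2[of _ _ _ _ "(*)"])
    fix z1 z2 assume "z1 \<in> words N a" "z2 \<in> words N b"
    then have "z1 @ z2 \<in> words N (a + b)" by (rule append_in_words)
    then show "(\<Sum>z3\<in>words N c. jw N x3 z3 * jw N (z1 @ z2 @ z3) y) = jw N (z1 @ z2 @ x3) y"
      using jw_reproduces[OF N harmonic_subword[of N "a + b" c 0 "\<lambda>z. jw N z y" "z1 @ z2" "[]"] x3] harm by simp
  qed
  also have "\<dots> = (\<Sum>z1\<in>words N a. jw N x1 z1 * jw N (z1 @ x2 @ x3) y)"
  proof (intro sum.cong refl arg_cong2[of _ _ _ _ "(*)"])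
    fix z1 assume "z1 \<in> words N a"
    then show "(\<Sum>z2\<in>words N b. jw N x2 z2 * jw N (z1 @ z2 @ x3) y) = jw N (z1 @ x2 @ x3) y"
      using jw_reproduces[OF N harmonic_subword[OF harm, of z1 x3] x12(2)] x3 by simp
  qed
  also have "\<dots> = jw N x y"
    using jw_reproduces[OF N harmonic_subword[of N 0 a "b + c" "\<lambda>z. jw N z y" "[]" "x2 @ x3"] x12(1)] harm x12 x3
    by (simp add: x' append_in_words add.assoc)
  finally show "(triple_proj a b c * JW N (a + b + c)) $$ (encode N x, encode N y) = JW N (a + b + c) $$ (encode N x, encode N y)"
    using x y by (simp add: JW_index)
qed (use mult_carrier_mat[OF triple_proj_carrier JW_carrier] JW_carrier in auto)

lemma transpose_JW: "transpose_mat (JW N n) = JW N n"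
  by (rule mat_eq_encodeI) (use JW_carrier in \<open>auto simp: encode_less JW_index jw_sym[OF N]\<close>)

lemma transpose_triple_proj: "transpose_mat (triple_proj a b c) = triple_proj a b c"
proof (rule mat_eq_encodeI)
  fix x y assume x: "x \<in> words N (a + b + c)" and y: "y \<in> words N (a + b + c)"
  obtain r x3 where "x = r @ x3" "r \<in> words N (a + b)" and x3: "x3 \<in> words N c"
    using words_add_split[OF x] .
  moreover obtain x1 x2 where "r = x1 @ x2" and x12: "x1 \<in> words N a" "x2 \<in> words N b"
    using words_add_split[OF \<open>r \<in> words N (a + b)\<close>] .
  moreover obtain s y3 where "y = s @ y3" "s \<in> words N (a + b)" and y3: "y3 \<in> words N c"
    using words_add_split[OF y] .
  moreover obtain y1 y2 where "s = y1 @ y2" and y12: "y1 \<in> words N a" "y2 \<in> words N b"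
    using words_add_split[OF \<open>s \<in> words N (a + b)\<close>] .
  ultimately have eq: "x = x1 @ x2 @ x3" "y = y1 @ y2 @ y3" by simp_all
  have "transpose_mat (triple_proj a b c) $$ (encode N x, encode N y) = triple_proj a b c $$ (encode N y, encode N x)"
    using encode_less[OF x] encode_less[OF y] triple_proj_carrier[of a b c] by simp
  then show "transpose_mat (triple_proj a b c) $$ (encode N x, encode N y) = triple_proj a b c $$ (encode N x, encode N y)"
    using x12 y12 x3 y3 unfolding eq by (simp add: triple_proj_index jw_sym[OF N])
qed (use triple_proj_carrier in auto)

text \<open>Both matrices are symmetric, so transposing the left absorption gives the right one, and
  the compression in \<open>JW3\<close> changes nothing.\<close>

lemma JW3_eq: "JW3 N a b c = JW N (a + b + c)"
proof -
  let ?E = "triple_proj a b c" and ?P = "JW N (a + b + c)"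
  have "?P * ?E = transpose_mat (?E * ?P)"
    using transpose_mult[OF triple_proj_carrier JW_carrier, of a b c]
    by (simp add: transpose_JW transpose_triple_proj)
  also have "\<dots> = ?P" by (simp add: triple_proj_absorb_left transpose_JW)
  finally show ?thesis
    by (simp add: JW3_def Let_def triple_proj_absorb_left flip: triple_proj_def)
qed

end

text \<open>The trace of an idempotent is its rank. Write P = A G with a basis of W as the columns
  of A; then P A = A and linear independence give G A = 1, and A G and G A have the same
  trace.\<close>

lemma subspace_dim_range_idempotent:
  assumes P: "P \<in> carrier_mat n n" and idem: "P * P = P"
    and W: "W = {P *\<^sub>v v | v. v \<in> carrier_vec n}"
  shows "of_nat (subspace_dim n W) = (\<Sum>i<n. P $$ (i, i))"
proof -
  interpret vec_space "TYPE(complex)" n .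
  have span: "W = span (set (cols P))"
    using col_space_eq[OF P] P by (auto simp: W col_space_def)
  have cols: "set (cols P) \<subseteq> carrier_vec n" using P cols_dim[of P] by auto
  then have sub: "submodule class_ring W V" unfolding span by (intro span_is_submodule) simp
  have vs: "vectorspace class_ring (vs W)"
    unfolding span using cols by (intro subspace_is_vs span_is_subspace) simp
  interpret W: vectorspace class_ring "vs W" by (rule vs)
  have "W.fin_dim" unfolding span using fin_dim_span_cols[OF P] .
  then obtain B where B: "finite B" "W.basis B" using W.finite_basis_exists by blast
  obtain us where us: "set us = B" "distinct us" using finite_distinct_list[OF B(1)] by blast
  define k where "k = length us"
  have dim: "subspace_dim n W = k"
    unfolding subspace_dim_def k_def using W.dim_basis[OF B] distinct_card[OF us(2)] us(1) by simp
  have BW: "B \<subseteq> W" using B(2) by (simp add: W.basis_def)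
  have spanB: "span B = W"
    using span_li_not_depend(1)[OF BW sub] B(2) by (simp add: W.basis_def)
  have indpt: "lin_indpt B"
    using span_li_not_depend(2)[OF BW sub] B(2) by (simp add: W.basis_def)
  have Wn: "W \<subseteq> carrier_vec n" unfolding W using P by auto
  define A where "A = mat_of_cols n us"
  have A: "A \<in> carrier_mat n k" by (simp add: A_def k_def)
  have colsA: "cols A = us" unfolding A_def using BW Wn us(1) by (intro cols_mat_of_cols) auto
  have "\<forall>j<n. \<exists>x\<in>carrier_vec k. A *\<^sub>v x = col P j"
  proof (intro allI impI)
    fix j assume j: "j < n"
    have "col P j \<in> set (cols P)" using P j by (auto simp: cols_def)
    then have "col P j \<in> W" unfolding span using in_own_span[of "set (cols P)"] cols by auto
    then have "col P j \<in> span (set (cols A))" by (simp add: colsA us(1) spanB)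
    then show "\<exists>x\<in>carrier_vec k. A *\<^sub>v x = col P j"
      using col_space_eq[OF A] A by (auto simp: col_space_def)
  qed
  then obtain g where g: "\<And>j. j < n \<Longrightarrow> g j \<in> carrier_vec k \<and> A *\<^sub>v g j = col P j" by metis
  define G where "G = mat_of_cols k (map g [0..<n])"
  have G: "G \<in> carrier_mat k n" by (simp add: G_def mat_of_cols_def)
  have colG: "col G j = g j" if "j < n" for j
    using that g by (simp add: G_def)
  have AG: "A * G = P"
  proof (rule mat_col_eqI)
    fix j assume "j < dim_col P"
    then have j: "j < n" using P by simp
    have "col (A * G) j = A *\<^sub>v col G j" using A G j by (intro col_mult2[OF A G])
    then show "col (A * G) j = col P j" using g[OF j] colG[OF j] by simp
  qed (use A G P in auto)
  have PA: "P * A = A"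
  proof (rule mat_col_eqI)
    fix j assume "j < dim_col A"
    then have j: "j < k" using A by simp
    then have colA: "col A j = us ! j" using colsA A by (metis carrier_matD(2) cols_nth)
    have "us ! j \<in> W" using j us(1) BW by (auto simp: k_def)
    then obtain v where v: "v \<in> carrier_vec n" "us ! j = P *\<^sub>v v" unfolding W by blast
    have "col (P * A) j = P *\<^sub>v (P *\<^sub>v v)"
      using col_mult2[OF P A j] colA v by simp
    also have "\<dots> = (P * P) *\<^sub>v v" using P v(1) by simp
    finally show "col (P * A) j = col A j" using idem colA v by simp
  qed (use A P in auto)
  have GA: "G * A = 1\<^sub>m k"
  proof (rule mat_col_eqI)
    fix j assume "j < dim_col (1\<^sub>m k :: complex mat)"
    then have j: "j < k" by simp
    define z where "z = col (G * A) j - unit_vec k j"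
    have c: "col (G * A) j \<in> carrier_vec k" by (rule col_carrier_vec[OF j mult_carrier_mat[OF G A]])
    have z: "z \<in> carrier_vec k" using c by (simp add: z_def)
    have "A *\<^sub>v col (G * A) j = col (A * (G * A)) j"
      using col_mult2[OF A mult_carrier_mat[OF G A] j] by simp
    also have "A * (G * A) = A" using assoc_mult_mat[OF A G A] AG PA by simp
    also have "col A j = A *\<^sub>v unit_vec k j"
      using A j by (auto intro!: eq_vecI)
    finally have "A *\<^sub>v z = 0\<^sub>v n"
      using mult_minus_distrib_mat_vec[OF A c unit_vec_carrier[of k j]] A by (simp add: z_def)
    then have "z = 0\<^sub>v k"
      using lin_depI[OF A z] indpt us by (auto simp: colsA)
    then have "col (G * A) j = unit_vec k j"
      using c G unfolding z_def
      by (intro eq_vecI) (auto simp: vec_eq_iff)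
    then show "col (G * A) j = col (1\<^sub>m k) j" using j by simp
  qed (use G A in auto)
  have "(\<Sum>i<n. P $$ (i, i)) = (\<Sum>i<n. \<Sum>l<k. A $$ (i, l) * G $$ (l, i))"
    unfolding AG[symmetric] using A G by (intro sum.cong refl) (simp add: scalar_prod_def atLeast0LessThan)
  also have "\<dots> = (\<Sum>l<k. \<Sum>i<n. A $$ (i, l) * G $$ (l, i))" by (rule sum.swap)
  also have "\<dots> = (\<Sum>l<k. (G * A) $$ (l, l))"
    using A G by (intro sum.cong refl) (simp add: scalar_prod_def atLeast0LessThan mult.commute)
  also have "\<dots> = of_nat k" by (simp add: GA)
  finally show ?thesis by (simp add: dim)
qed

text \<open>The formula d_n = (q^(n+1) - q^(-n-1)) / (q - q^(-1)), multiplied out so that no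
  negative powers occur.\<close>

lemma qdim_closed_form:
  fixes q :: real
  assumes "q + inverse q = real N" "0 < q"
  shows "qdim N n * q ^ n * (1 - q\<^sup>2) = 1 - q ^ (2 * n + 2)"
  using assms(1)
proof (induction N n rule: qdim.induct)
  case (1 N)
  then show ?case by (simp add: power2_eq_square)
next
  case (2 N)
  have "real N * q = 1 + q\<^sup>2"
    using 2 assms(2) by (simp add: power2_eq_square field_simps flip: 2)
  then have "qdim N (Suc 0) * q ^ Suc 0 * (1 - q\<^sup>2) = (1 + q\<^sup>2) * (1 - q\<^sup>2)" by simp
  then show ?case by (simp add: algebra_simps power_eq_if)
next
  case (3 N n)
  have Nq: "real N * q = 1 + q\<^sup>2"
    using assms(2) by (simp add: power2_eq_square field_simps flip: 3(3))
  have "qdim N (Suc (Suc n)) * q ^ Suc (Suc n) * (1 - q\<^sup>2) =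
      real N * q * (qdim N (Suc n) * q ^ Suc n * (1 - q\<^sup>2)) - q\<^sup>2 * (qdim N n * q ^ n * (1 - q\<^sup>2))"
    by (simp add: algebra_simps power2_eq_square)
  also have "\<dots> = (1 + q\<^sup>2) * (1 - q ^ (2 * Suc n + 2)) - q\<^sup>2 * (1 - q ^ (2 * n + 2))"
    using 3 by (simp only: Nq)
  also have "\<dots> = 1 - q ^ (2 * Suc (Suc n) + 2)"
    by (simp add: algebra_simps power2_eq_square)
  finally show ?case .
qed

section \<open>Product vectors and norm estimates\<close>

lemma kron_vec_index:
  "v \<in> carrier_vec m \<Longrightarrow> w \<in> carrier_vec n \<Longrightarrow> i < m \<Longrightarrow> j < n \<Longrightarrow> kron_vec v w $ (i * n + j) = v $ i * w $ j"
  by (auto simp: kron_vec_def mult_add_less)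

lemma kron_vec_carrier: "v \<in> carrier_vec m \<Longrightarrow> w \<in> carrier_vec n \<Longrightarrow> kron_vec v w \<in> carrier_vec (m * n)"
  by (auto simp: kron_vec_def)

lemma smult_mat_mult_vec:
  "A \<in> carrier_mat m n \<Longrightarrow> v \<in> carrier_vec n \<Longrightarrow> (k \<cdot>\<^sub>m A) *\<^sub>v v = k \<cdot>\<^sub>v (A *\<^sub>v v)"
  for k :: complex
  by (intro eq_vecI) (auto simp: scalar_prod_def sum_distrib_left mult.assoc)

lemma euclid_norm_zero: "euclid_norm (0\<^sub>v n) = 0"
  by (simp add: euclid_norm_def L2_set_def)

lemma cmod_index_le_euclid_norm: "i < dim_vec v \<Longrightarrow> cmod (v $ i) \<le> euclid_norm v"
  unfolding euclid_norm_def using member_le_L2_set[of "{..<dim_vec v}" i "\<lambda>i. cmod (v $ i)"] by simp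

text \<open>Coordinates of v are at most 1 in absolute value. The crude factor n * n is affordable,
  because n will be \<open>N ^ (a + c)\<close>, independent of b.\<close>

lemma euclid_norm_mult_le:
  assumes A: "A \<in> carrier_mat n n" and v: "v \<in> carrier_vec n" "euclid_norm v \<le> 1"
    and bound: "\<And>i j. i < n \<Longrightarrow> j < n \<Longrightarrow> cmod (A $$ (i, j)) \<le> e"
  shows "euclid_norm (A *\<^sub>v v) \<le> real n * (real n * e)"
proof -
  have entry: "cmod ((A *\<^sub>v v) $ i) \<le> real n * e" if i: "i < n" for i
  proof -
    have "cmod ((A *\<^sub>v v) $ i) = cmod (\<Sum>j<n. A $$ (i, j) * v $ j)"
      using A v i by (simp add: scalar_prod_def atLeast0LessThan)
    also have "\<dots> \<le> (\<Sum>j<n. cmod (A $$ (i, j)) * cmod (v $ j))"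
      by (rule order_trans[OF norm_sum]) (simp add: norm_mult)
    also have "\<dots> \<le> (\<Sum>j<n. e)"
    proof (rule sum_mono)
      fix j assume j: "j \<in> {..<n}"
      have "cmod (v $ j) \<le> 1" using cmod_index_le_euclid_norm[of j v] v j by auto
      then have "cmod (A $$ (i, j)) * cmod (v $ j) \<le> cmod (A $$ (i, j)) * 1"
        by (intro mult_left_mono) auto
      also have "\<dots> \<le> e" using bound[OF i, of j] j by simp
      finally show "cmod (A $$ (i, j)) * cmod (v $ j) \<le> e" .
    qed
    finally show ?thesis by simp
  qed
  have dim: "dim_vec (A *\<^sub>v v) = n" using A by simp
  have "euclid_norm (A *\<^sub>v v) \<le> (\<Sum>i<n. \<bar>cmod ((A *\<^sub>v v) $ i)\<bar>)"
    unfolding euclid_norm_def dim by (rule L2_set_le_sum_abs)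
  also have "\<dots> \<le> (\<Sum>i<n. real n * e)"
    by (rule sum_mono) (use entry in auto)
  finally show ?thesis by simp
qed

text \<open>The zero vector makes the set under \<open>Sup\<close> nonempty and the estimate makes
  it bounded above; \<open>Sup\<close> on the reals is informative only then.\<close>

lemma op_norm_on_bounds:
  assumes "0\<^sub>v n \<in> W" "A \<in> carrier_mat n n"
    and "\<And>v. v \<in> W \<Longrightarrow> euclid_norm v \<le> 1 \<Longrightarrow> euclid_norm (A *\<^sub>v v) \<le> e"
  shows "0 \<le> op_norm_on W A" "op_norm_on W A \<le> e"
proof -
  let ?S = "{euclid_norm (A *\<^sub>v v) | v. v \<in> W \<and> euclid_norm v \<le> 1}"
  have "A *\<^sub>v 0\<^sub>v n = 0\<^sub>v n" using assms(2) by (intro eq_vecI) auto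
  then have zero: "0 \<in> ?S"
    using assms(1) by (intro CollectI exI[of _ "0\<^sub>v n"]) (simp add: euclid_norm_zero)
  have "bdd_above ?S" using assms(3) by (intro bdd_aboveI[of _ e]) auto
  with zero show "0 \<le> op_norm_on W A"
    unfolding op_norm_on_def by (rule cSup_upper)
  show "op_norm_on W A \<le> e"
    unfolding op_norm_on_def using zero assms(3) by (intro cSup_least) auto
qed

section \<open>The operator \<open>x_op\<close> on \<open>HH\<close> and its limit\<close>

context
  fixes N :: nat
  assumes N: "N > 2"
begin

lemma subspace_dim_H: "real (subspace_dim (N ^ n) (H N n)) = qdim N n"
proof -
  have "of_nat (subspace_dim (N ^ n) (H N n)) = (\<Sum>i<N ^ n. JW N n $$ (i, i))"
    by (rule subspace_dim_range_idempotent[OF JW_carrier[OF N] JW_idem[OF N] H_eq_range[OF N]])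
  also have "\<dots> = complex_of_real (qdim N n)"
    by (simp add: sum_encode JW_index[OF N] jw_trace[OF N] flip: of_real_sum)
  finally show ?thesis by (metis of_real_eq_iff of_real_of_nat_eq)
qed

definition x_kernel where
  "x_kernel b c s p t r = (\<Sum>m\<in>words N b. jw N (s @ m @ p) (t @ m @ r)) / qdim N b"

lemma x_op_carrier: "x_op N a b c \<in> carrier_mat (N ^ (a + c)) (N ^ (a + c))"
  by (simp add: x_op_def ptrace_mid_def power_add)

lemma x_op_index:
  assumes s: "s \<in> words N a" and t: "t \<in> words N a" and p: "p \<in> words N c" and r: "r \<in> words N c"
  shows "x_op N a b c $$ (encode N (s @ p), encode N (t @ r)) = complex_of_real (x_kernel b c s p t r)"
proof -
  have e: "encode N (s @ p) < N ^ a * N ^ c" "encode N (t @ r) < N ^ a * N ^ c"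
    using encode_less append_in_words s t p r by (simp_all flip: power_add)
  have split: "encode N (s @ p) div N ^ c = encode N s" "encode N (s @ p) mod N ^ c = encode N p"
    "encode N (t @ r) div N ^ c = encode N t" "encode N (t @ r) mod N ^ c = encode N r"
    using N p r encode_less[OF p] encode_less[OF r] by (simp_all add: encode_append_words)
  let ?T = "ptrace_mid (N ^ a) (N ^ b) (N ^ c) (JW3 N a b c)"
  have "?T $$ (encode N (s @ p), encode N (t @ r)) =
      (\<Sum>k<N ^ b. JW N (a + b + c) $$ ((encode N s * N ^ b + k) * N ^ c + encode N p, (encode N t * N ^ b + k) * N ^ c + encode N r))"
    using e by (simp add: ptrace_mid_def JW3_eq[OF N] split)
  also have "\<dots> = (\<Sum>m\<in>words N b. JW N (a + b + c) $$ (encode N (s @ m @ p), encode N (t @ m @ r)))"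
    unfolding sum_encode
    by (intro sum.cong refl arg_cong2[of _ _ _ _ "\<lambda>i j. JW N (a + b + c) $$ (i, j)"])
       (use p r in \<open>simp_all add: encode_append length_words algebra_simps power_add\<close>)
  also have "\<dots> = complex_of_real (\<Sum>m\<in>words N b. jw N (s @ m @ p) (t @ m @ r))"
    unfolding of_real_sum
    by (intro sum.cong refl JW_index[OF N]) (use s t p r in \<open>auto simp: words_def\<close>)
  finally have T: "?T $$ (encode N (s @ p), encode N (t @ r)) =
      complex_of_real (\<Sum>m\<in>words N b. jw N (s @ m @ p) (t @ m @ r))" .
  have "dim_row ?T = N ^ a * N ^ c" "dim_col ?T = N ^ a * N ^ c" by (simp_all add: ptrace_mid_def)
  then have "x_op N a b c $$ (encode N (s @ p), encode N (t @ r)) =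
      1 / of_nat (subspace_dim (N ^ b) (H N b)) * ?T $$ (encode N (s @ p), encode N (t @ r))"
    using e unfolding x_op_def by simp
  also have "complex_of_nat (subspace_dim (N ^ b) (H N b)) = complex_of_real (qdim N b)"
    using subspace_dim_H[of b] by (metis of_real_of_nat_eq)
  finally show ?thesis by (simp add: T x_kernel_def)
qed

lemma product_proj_apply:
  assumes v: "v \<in> carrier_vec (N ^ a)" and w: "w \<in> carrier_vec (N ^ c)"
  shows "product_proj N a c *\<^sub>v kron_vec v w = kron_vec (JW N a *\<^sub>v v) (JW N c *\<^sub>v w)"
proof (rule eq_vecI)
  have vw: "kron_vec v w \<in> carrier_vec (N ^ (a + c))"
    using kron_vec_carrier[OF v w] by (simp add: power_add)
  have Pv: "JW N a *\<^sub>v v \<in> carrier_vec (N ^ a)" and Pw: "JW N c *\<^sub>v w \<in> carrier_vec (N ^ c)"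
    using v w by (auto intro: mult_mat_vec_carrier[OF JW_carrier[OF N]])
  have Pvw: "kron_vec (JW N a *\<^sub>v v) (JW N c *\<^sub>v w) \<in> carrier_vec (N ^ (a + c))"
    using kron_vec_carrier[OF Pv Pw] by (simp add: power_add)
  show "dim_vec (product_proj N a c *\<^sub>v kron_vec v w) = dim_vec (kron_vec (JW N a *\<^sub>v v) (JW N c *\<^sub>v w))"
    using Pvw product_proj_carrier[OF N, of a c] by simp
  fix k assume "k < dim_vec (kron_vec (JW N a *\<^sub>v v) (JW N c *\<^sub>v w))"
  then have "k < N ^ (a + c)" using Pvw by simp
  then obtain y where y: "y \<in> words N (a + c)" "k = encode N y" by (rule encodeE)
  obtain s p where sp: "y = s @ p" "s \<in> words N a" "p \<in> words N c" using words_add_split[OF y(1)] .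
  have "(product_proj N a c *\<^sub>v kron_vec v w) $ k =
      (\<Sum>t\<in>words N a. \<Sum>r\<in>words N c. product_proj N a c $$ (encode N (s @ p), encode N (t @ r)) * kron_vec v w $ encode N (t @ r))"
    using y sp by (subst index_mult_vec_encode[OF product_proj_carrier[OF N] vw]) (auto simp: encode_less sum_words_add)
  also have "\<dots> = (\<Sum>t\<in>words N a. \<Sum>r\<in>words N c. (complex_of_real (jw N s t) * v $ encode N t) * (complex_of_real (jw N p r) * w $ encode N r))"
  proof (intro sum.cong refl)
    fix t r assume t: "t \<in> words N a" and r: "r \<in> words N c"
    have "kron_vec v w $ encode N (t @ r) = v $ encode N t * w $ encode N r"
      using t r by (simp add: encode_append_words kron_vec_index[OF v w] encode_less)
    then show "product_proj N a c $$ (encode N (s @ p), encode N (t @ r)) * kron_vec v w $ encode N (t @ r) =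
        (complex_of_real (jw N s t) * v $ encode N t) * (complex_of_real (jw N p r) * w $ encode N r)"
      by (simp add: product_proj_index[OF N sp(2) t sp(3) r])
  qed
  also have "\<dots> = (JW N a *\<^sub>v v) $ encode N s * (JW N c *\<^sub>v w) $ encode N p"
    using jw_mat_apply[OF N v sp(2)] jw_mat_apply[OF N w sp(3)]
    by (simp add: JW_eq[OF N] sum_product)
  also have "\<dots> = kron_vec (JW N a *\<^sub>v v) (JW N c *\<^sub>v w) $ k"
    using y sp by (simp add: encode_append_words kron_vec_index[OF Pv Pw] encode_less)
  finally show "(product_proj N a c *\<^sub>v kron_vec v w) $ k = kron_vec (JW N a *\<^sub>v v) (JW N c *\<^sub>v w) $ k" .
qed

lemma HH_generators:
  "{kron_vec v w |v w. v \<in> H N a \<and> w \<in> H N c} \<subseteq> carrier_vec (N ^ (a + c))"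
  using kron_vec_carrier[of _ "N ^ a" _ "N ^ c"] by (auto simp: H_def power_add)

text \<open>The vectors fixed by the product projection form a submodule that contains the
  generating simple tensors, hence their span.\<close>

lemma HH_carrier_and_fixed:
  assumes "x \<in> HH N a c"
  shows "x \<in> carrier_vec (N ^ (a + c))" "product_proj N a c *\<^sub>v x = x"
proof -
  interpret vec_space "TYPE(complex)" "N ^ (a + c)" .
  let ?F = "{x \<in> carrier_vec (N ^ (a + c)). product_proj N a c *\<^sub>v x = x}"
  have Q: "product_proj N a c \<in> carrier_mat (N ^ (a + c)) (N ^ (a + c))"
    by (rule product_proj_carrier[OF N])
  have "submodule class_ring ?F V"
    by unfold_locales
       (use Q in \<open>auto simp: mult_add_distrib_mat_vec[OF Q] mult_mat_vec[OF Q] intro!: eq_vecI\<close>)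
  moreover have "{kron_vec v w |v w. v \<in> H N a \<and> w \<in> H N c} \<subseteq> ?F"
  proof (intro subsetI CollectI conjI)
    fix x assume x: "x \<in> {kron_vec v w |v w. v \<in> H N a \<and> w \<in> H N c}"
    then show "x \<in> carrier_vec (N ^ (a + c))" using HH_generators by blast
    from x obtain v w where vw: "x = kron_vec v w" "v \<in> H N a" "w \<in> H N c" by blast
    then have "v \<in> carrier_vec (N ^ a)" "w \<in> carrier_vec (N ^ c)" by (auto simp: H_def)
    then show "product_proj N a c *\<^sub>v x = x"
      using vw by (simp add: product_proj_apply JW_fixes[OF N])
  qed
  ultimately have "HH N a c \<subseteq> ?F"
    unfolding HH_def tensor_subspace_def power_add[symmetric] by (intro span_is_subset)
  with assms show "x \<in> carrier_vec (N ^ (a + c))" "product_proj N a c *\<^sub>v x = x" by auto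
qed

lemma zero_in_HH: "0\<^sub>v (N ^ (a + c)) \<in> HH N a c"
proof -
  interpret vec_space "TYPE(complex)" "N ^ (a + c)" .
  have "submodule class_ring (HH N a c) V"
    unfolding HH_def tensor_subspace_def power_add[symmetric]
    by (rule span_is_submodule) (use HH_generators in simp)
  from submodule.zero_closed[OF this] show ?thesis by simp
qed

lemma product_proj_in_HH:
  assumes y: "y \<in> carrier_vec (N ^ (a + c))"
  shows "product_proj N a c *\<^sub>v y \<in> HH N a c"
proof -
  interpret vec_space "TYPE(complex)" "N ^ (a + c)" .
  let ?Q = "product_proj N a c"
  have Q: "?Q \<in> carrier_mat (N ^ (a + c)) (N ^ (a + c))"
    by (rule product_proj_carrier[OF N])
  have sub: "submodule class_ring (HH N a c) V"
    unfolding HH_def tensor_subspace_def power_add[symmetric]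
    by (rule span_is_submodule) (use HH_generators in simp)
  have unit: "?Q *\<^sub>v unit_vec (N ^ (a + c)) k \<in> HH N a c" if "k < N ^ (a + c)" for k
  proof -
    obtain z where z: "z \<in> words N (a + c)" "k = encode N z" using \<open>k < N ^ (a + c)\<close> by (rule encodeE)
    obtain t r where tr: "z = t @ r" "t \<in> words N a" "r \<in> words N c" using words_add_split[OF z(1)] .
    let ?u = "unit_vec (N ^ a) (encode N t) :: complex vec" and ?w = "unit_vec (N ^ c) (encode N r) :: complex vec"
    have "unit_vec (N ^ (a + c)) k = kron_vec ?u ?w"
    proof (rule eq_vecI)
      fix j assume "j < dim_vec (kron_vec ?u ?w)"
      then have "j < N ^ (a + c)" by (simp add: kron_vec_def power_add)
      then obtain x where x: "x \<in> words N (a + c)" "j = encode N x" by (rule encodeE)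
      obtain s p where sp: "x = s @ p" "s \<in> words N a" "p \<in> words N c" using words_add_split[OF x(1)] .
      have "kron_vec ?u ?w $ j = ?u $ encode N s * ?w $ encode N p"
        using sp x by (simp add: encode_append_words kron_vec_index[of _ "N ^ a" _ "N ^ c"] encode_less)
      also have "\<dots> = of_bool (s = t \<and> p = r)"
        using sp tr by (auto simp: unit_vec_def encode_less encode_eq_iff)
      also have "\<dots> = unit_vec (N ^ (a + c)) k $ j"
        using x z sp tr encode_eq_iff[OF x(1) z(1)] encode_less[OF x(1)] encode_less[OF z(1)]
        by (auto simp: unit_vec_def length_words)
      finally show "unit_vec (N ^ (a + c)) k $ j = kron_vec ?u ?w $ j" by simp
    qed (simp add: kron_vec_def power_add)
    then have "?Q *\<^sub>v unit_vec (N ^ (a + c)) k = kron_vec (JW N a *\<^sub>v ?u) (JW N c *\<^sub>v ?w)"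
      by (simp add: product_proj_apply)
    also have "\<dots> \<in> {kron_vec v w |v w. v \<in> H N a \<and> w \<in> H N c}"
      using JW_range[OF N unit_vec_carrier[of "N ^ a"]] JW_range[OF N unit_vec_carrier[of "N ^ c"]] by blast
    also have "\<dots> \<subseteq> HH N a c"
      unfolding HH_def tensor_subspace_def power_add[symmetric]
      by (rule in_own_span) (use HH_generators in simp)
    finally show ?thesis .
  qed
  \<comment> \<open>Truncations build y from unit vectors one coordinate at a time, so that closure
    of \<open>HH\<close> under addition and scaling is all that is needed.\<close>
  define trunc where "trunc k = vec (N ^ (a + c)) (\<lambda>i. if i < k then y $ i else 0)" for k
  have "k \<le> N ^ (a + c) \<Longrightarrow> ?Q *\<^sub>v trunc k \<in> HH N a c" for k
  proof (induction k)
    case 0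
    have "trunc 0 = 0\<^sub>v (N ^ (a + c))" by (auto simp: trunc_def)
    then have "?Q *\<^sub>v trunc 0 = 0\<^sub>v (N ^ (a + c))" using Q by (auto intro!: eq_vecI)
    then show ?case using zero_in_HH by simp
  next
    case (Suc k)
    have c: "trunc k \<in> carrier_vec (N ^ (a + c))" by (simp add: trunc_def)
    have "trunc (Suc k) = trunc k + y $ k \<cdot>\<^sub>v unit_vec (N ^ (a + c)) k"
      using Suc.prems by (auto simp: trunc_def less_Suc_eq intro!: eq_vecI)
    then have "?Q *\<^sub>v trunc (Suc k) = ?Q *\<^sub>v trunc k + y $ k \<cdot>\<^sub>v (?Q *\<^sub>v unit_vec (N ^ (a + c)) k)"
      using c mult_add_distrib_mat_vec[OF Q c] mult_mat_vec[OF Q] by simp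
    moreover have "y $ k \<cdot>\<^sub>v (?Q *\<^sub>v unit_vec (N ^ (a + c)) k) \<in> HH N a c"
      using submodule.smult_closed[OF sub, of "y $ k"] unit[of k] Suc.prems by simp
    ultimately show ?case
      using submodule.m_closed[OF sub, of "?Q *\<^sub>v trunc k"] Suc by simp
  qed
  moreover have "trunc (N ^ (a + c)) = y"
    using y by (auto simp: trunc_def intro!: eq_vecI)
  ultimately show ?thesis by (metis order_refl)
qed

text \<open>The outer legs of P_(a+b+c) absorb P_a and P_c, and the trace over the middle leg does
  not interfere. It follows in the theorem that \<open>x_op\<close> maps \<open>HH\<close> into
  itself.\<close>

lemma product_proj_x_op: "product_proj N a c * x_op N a b c = x_op N a b c"
proof (rule mat_eq_encodeI)
  fix x y assume x: "x \<in> words N (a + c)" and y: "y \<in> words N (a + c)"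
  obtain s p where sp: "x = s @ p" "s \<in> words N a" "p \<in> words N c" using words_add_split[OF x] .
  obtain t r where tr: "y = t @ r" "t \<in> words N a" "r \<in> words N c" using words_add_split[OF y] .
  have "(product_proj N a c * x_op N a b c) $$ (encode N x, encode N y) =
      (\<Sum>s'\<in>words N a. \<Sum>p'\<in>words N c. product_proj N a c $$ (encode N (s @ p), encode N (s' @ p')) *
         x_op N a b c $$ (encode N (s' @ p'), encode N (t @ r)))"
    using x y sp tr
    by (subst index_mult_mat_encode[OF product_proj_carrier[OF N] x_op_carrier]) (auto simp: encode_less sum_words_add)
  also have "\<dots> = (\<Sum>s'\<in>words N a. \<Sum>p'\<in>words N c. complex_of_real (jw N s s' * (jw N p p' * x_kernel b c s' p' t r)))"
    by (intro sum.cong refl) (use sp tr in \<open>simp add: product_proj_index[OF N] x_op_index\<close>)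
  also have "\<dots> = complex_of_real (\<Sum>s'\<in>words N a. jw N s s' * (\<Sum>p'\<in>words N c. jw N p p' * x_kernel b c s' p' t r))"
    by (simp only: of_real_sum sum_distrib_left)
  also have "(\<Sum>s'\<in>words N a. jw N s s' * (\<Sum>p'\<in>words N c. jw N p p' * x_kernel b c s' p' t r)) =
      (\<Sum>s'\<in>words N a. jw N s s' * x_kernel b c s' p t r)"
  proof (intro sum.cong refl arg_cong2[of _ _ _ _ "(*)"])
    fix s' assume s': "s' \<in> words N a"
    have "(\<Sum>p'\<in>words N c. jw N p p' * x_kernel b c s' p' t r) =
      (\<Sum>m\<in>words N b. (\<Sum>p'\<in>words N c. jw N p p' * jw N (s' @ m @ p') (t @ m @ r))) / qdim N b"
      by (subst sum.swap) (simp add: x_kernel_def sum_distrib_left sum_divide_distrib)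
    also have "\<dots> = x_kernel b c s' p t r"
      unfolding x_kernel_def
    proof (intro sum.cong refl arg_cong2[of _ _ _ _ "(/)"])
      fix m assume m: "m \<in> words N b"
      have tmr: "t @ m @ r \<in> words N (a + b + c)" using tr m by (auto simp: words_def)
      show "(\<Sum>p'\<in>words N c. jw N p p' * jw N (s' @ m @ p') (t @ m @ r)) = jw N (s' @ m @ p) (t @ m @ r)"
        using jw_reproduces[OF N harmonic_subword[of N "a + b" c 0 "\<lambda>z. jw N z (t @ m @ r)" "s' @ m" "[]"] sp(3)]
          harmonic_jw_left[OF N tmr] append_in_words[OF s' m] by simp
    qed
    finally show "(\<Sum>p'\<in>words N c. jw N p p' * x_kernel b c s' p' t r) = x_kernel b c s' p t r" .
  qed
  also have "\<dots> = (\<Sum>m\<in>words N b. (\<Sum>s'\<in>words N a. jw N s s' * jw N (s' @ m @ p) (t @ m @ r))) / qdim N b"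
    by (subst sum.swap) (simp add: x_kernel_def sum_distrib_left sum_divide_distrib)
  also have "\<dots> = x_kernel b c s p t r"
    unfolding x_kernel_def
  proof (intro sum.cong refl arg_cong2[of _ _ _ _ "(/)"])
    fix m assume m: "m \<in> words N b"
    have tmr: "t @ m @ r \<in> words N (a + b + c)" using tr m by (auto simp: words_def)
    show "(\<Sum>s'\<in>words N a. jw N s s' * jw N (s' @ m @ p) (t @ m @ r)) = jw N (s @ m @ p) (t @ m @ r)"
      using jw_reproduces[OF N harmonic_subword[of N 0 a "b + c" "\<lambda>z. jw N z (t @ m @ r)" "[]" "m @ p"] sp(2)]
        harmonic_jw_left[OF N tmr] append_in_words[OF m sp(3)] by (simp add: add.assoc)
  qed
  finally show "(product_proj N a c * x_op N a b c) $$ (encode N x, encode N y) = x_op N a b c $$ (encode N x, encode N y)"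
    using sp tr by (simp add: x_op_index)
qed (rule mult_carrier_mat[OF product_proj_carrier[OF N] x_op_carrier] x_op_carrier)+

lemma jw_abs_le:
  assumes x: "x \<in> words N n" and y: "y \<in> words N n"
  shows "\<bar>jw N x y\<bar> \<le> qdim N n"
proof -
  have "jw N z z \<le> qdim N n" if "z \<in> words N n" for z
    unfolding jw_trace[OF N, of n, symmetric]
    by (rule member_le_sum[OF that]) (use jw_diag_nonneg[OF N] in auto)
  from this[OF x] this[OF y] show ?thesis using jw_le_diag[OF N x y] by simp
qed

text \<open>Two errors add up: the bounded one of \<open>jw_factorization\<close>, divided by d_b >=
  q^(-b), and the distance of d_(a+b+c) / d_b from its limit q^(-(a+c)), multiplied by a factor J of
  absolute value at most 1.\<close>

lemma x_kernel_approx: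
  fixes q :: real
  assumes q: "0 < q" "q < 1" "q + inverse q = real N"
  shows "\<exists>D\<ge>0. \<forall>b. \<forall>s\<in>words N a. \<forall>t\<in>words N a. \<forall>p\<in>words N c. \<forall>r\<in>words N c.
    \<bar>x_kernel b c s p t r - 1 / (q ^ (a + c) * qdim N a * qdim N c) * (jw N s t * jw N p r)\<bar> \<le> D * q ^ b"
proof -
  define m where "m = a + c"
  obtain D0 where D0: "\<bar>(\<Sum>m\<in>words N b. jw N (s @ m @ p) (t @ m @ r))
      - qdim N (a + b + c) / (qdim N a * qdim N c) * jw N s t * jw N p r\<bar> \<le> D0"
    if "s \<in> words N a" "t \<in> words N a" "p \<in> words N c" "r \<in> words N c" for b s t p r
    using jw_factorization[OF N, of a c] by blast
  define D1 where "D1 = \<bar>D0\<bar>"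
  \<comment> \<open>In the closed form of the ratio the denominator is q^m z with z >= 1 - q^2, and
    the numerator is at most q^b.\<close>
  define D2 where "D2 = 1 / (q ^ m * (1 - q\<^sup>2))"
  have q2: "0 < 1 - q\<^sup>2" using q by (simp add: power_less_one_iff abs_square_less_1)
  have closed: "qdim N n * q ^ n * (1 - q\<^sup>2) = 1 - q ^ (2 * n + 2)" for n
    using q by (intro qdim_closed_form)
  have pos: "qdim N n > 0" for n by (rule qdim_pos[OF N])
  have ge: "1 - q ^ (2 * n + 2) \<ge> 1 - q\<^sup>2" for n
    using power_decreasing[of 2 "2 * n + 2" q] q by simp
  have inv: "1 / qdim N b \<le> q ^ b" for b
  proof -
    have "1 * (1 - q\<^sup>2) \<le> qdim N b * q ^ b * (1 - q\<^sup>2)" using closed[of b] ge[of b] by simp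
    then have "1 \<le> qdim N b * q ^ b" using q2 by (rule mult_right_le_imp_le)
    then show ?thesis using pos[of b] by (simp add: field_simps)
  qed
  have ratio: "\<bar>qdim N (b + m) / qdim N b - 1 / q ^ m\<bar> \<le> D2 * q ^ b" for b
  proof -
    define z where "z = 1 - q ^ (2 * b + 2)"
    have z: "z \<ge> 1 - q\<^sup>2" "z > 0" using ge[of b] q2 by (auto simp: z_def)
    have e1: "qdim N (b + m) = (1 - q ^ (2 * (b + m) + 2)) / (q ^ (b + m) * (1 - q\<^sup>2))"
      using closed[of "b + m"] q q2 by (simp add: field_simps)
    have e2: "qdim N b = z / (q ^ b * (1 - q\<^sup>2))"
      using closed[of b] q q2 by (simp add: field_simps z_def)
    have "qdim N (b + m) / qdim N b = (1 - q ^ (2 * (b + m) + 2)) / (q ^ m * z)"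
      unfolding e1 e2 using q q2 z by (simp add: field_simps power_add)
    also have "\<dots> - 1 / q ^ m = (q ^ (2 * b + 2) - q ^ (2 * (b + m) + 2)) / (q ^ m * z)"
      using q z by (simp add: field_simps z_def)
    finally have eq: "qdim N (b + m) / qdim N b - 1 / q ^ m = (q ^ (2 * b + 2) - q ^ (2 * (b + m) + 2)) / (q ^ m * z)" .
    have "q ^ (2 * (b + m) + 2) \<le> q ^ (2 * b + 2)" "q ^ (2 * b + 2) \<le> q ^ b"
      using q by (intro power_decreasing; simp)+
    moreover have "0 \<le> q ^ (2 * (b + m) + 2)" using q by (intro zero_le_power) simp
    ultimately have "\<bar>q ^ (2 * b + 2) - q ^ (2 * (b + m) + 2)\<bar> \<le> q ^ b" by linarith
    then have "\<bar>q ^ (2 * b + 2) - q ^ (2 * (b + m) + 2)\<bar> / (q ^ m * z) \<le> q ^ b / (q ^ m * (1 - q\<^sup>2))"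
      using q q2 z by (intro frac_le mult_left_mono mult_pos_pos zero_less_power zero_le_power; simp)
    then show ?thesis unfolding eq using q z by (simp add: D2_def abs_mult)
  qed
  have "\<bar>x_kernel b c s p t r - 1 / (q ^ m * qdim N a * qdim N c) * (jw N s t * jw N p r)\<bar> \<le> (D1 + D2) * q ^ b"
    if *: "s \<in> words N a" "t \<in> words N a" "p \<in> words N c" "r \<in> words N c" for b s t p r
  proof -
    define S where "S = (\<Sum>m\<in>words N b. jw N (s @ m @ p) (t @ m @ r))"
    define J where "J = jw N s t * jw N p r / (qdim N a * qdim N c)"
    have J: "\<bar>J\<bar> \<le> 1"
    proof -
      have "\<bar>jw N s t\<bar> * \<bar>jw N p r\<bar> \<le> qdim N a * qdim N c"
        using jw_abs_le[of s a t] jw_abs_le[of p c r] * pos[of a] by (intro mult_mono) auto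
      then show ?thesis using pos[of a] pos[of c] by (simp add: J_def abs_mult)
    qed
    have "x_kernel b c s p t r - 1 / (q ^ m * qdim N a * qdim N c) * (jw N s t * jw N p r) =
        (S - qdim N (b + m) * J) / qdim N b + (qdim N (b + m) / qdim N b - 1 / q ^ m) * J"
    proof -
      have "1 / (q ^ m * qdim N a * qdim N c) * (jw N s t * jw N p r) = 1 / q ^ m * J"
        by (simp add: J_def)
      moreover have "x_kernel b c s p t r = S / qdim N b" by (simp add: x_kernel_def S_def)
      ultimately show ?thesis by (simp add: diff_divide_distrib left_diff_distrib)
    qed
    also have "\<bar>\<dots>\<bar> \<le> \<bar>S - qdim N (b + m) * J\<bar> * (1 / qdim N b) + \<bar>qdim N (b + m) / qdim N b - 1 / q ^ m\<bar> * \<bar>J\<bar>"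
      using pos[of b] by (intro order_trans[OF abs_triangle_ineq]) (simp add: abs_mult)
    also have "\<dots> \<le> D1 * q ^ b + D2 * q ^ b * 1"
    proof (intro add_mono mult_mono inv ratio J)
      show "\<bar>S - qdim N (b + m) * J\<bar> \<le> D1"
        using D0[OF *, of b] by (simp add: S_def J_def D1_def m_def add_ac)
    qed (use q q2 pos[of b] in \<open>auto simp: D1_def D2_def less_imp_le\<close>)
    finally show ?thesis by (simp add: distrib_right)
  qed
  moreover have "0 \<le> D1 + D2" using q q2 by (simp add: D1_def D2_def)
  ultimately show ?thesis unfolding m_def by blast
qed

end

theorem proposition3p2:
  fixes N :: nat and q :: real
  assumes "N > 2" and "0 < q" and "q < 1" and "q + inverse q = real N"
  shows "\<forall>a c. \<exists>lam D :: real. lam > 0 \<and> D > 0 \<and>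
    (\<forall>b. (\<forall>v \<in> HH N a c. x_op N a b c *\<^sub>v v \<in> HH N a c) \<and>
      op_norm_on (HH N a c)
        (x_op N a b c - complex_of_real lam \<cdot>\<^sub>m 1\<^sub>m (N ^ a * N ^ c)) \<le> D * q ^ b) \<and>
    (\<lambda>b. op_norm_on (HH N a c)
        (x_op N a b c - complex_of_real lam \<cdot>\<^sub>m 1\<^sub>m (N ^ a * N ^ c))) \<longlonglongrightarrow> 0"
proof (intro allI)
  fix a c
  note N = \<open>N > 2\<close> and q = \<open>0 < q\<close> \<open>q < 1\<close> \<open>q + inverse q = real N\<close>
  define K where "K = N ^ (a + c)"
  define lam where "lam = 1 / (q ^ (a + c) * qdim N a * qdim N c)"
  obtain D0 where D0: "D0 \<ge> 0" and "\<forall>b. \<forall>s\<in>words N a. \<forall>t\<in>words N a. \<forall>p\<in>words N c. \<forall>r\<in>words N c.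
      \<bar>x_kernel N b c s p t r - lam * (jw N s t * jw N p r)\<bar> \<le> D0 * q ^ b"
    using x_kernel_approx[OF N q, of a c] unfolding lam_def by blast
  then have approx: "\<bar>x_kernel N b c s p t r - lam * (jw N s t * jw N p r)\<bar> \<le> D0 * q ^ b"
    if "s \<in> words N a" "t \<in> words N a" "p \<in> words N c" "r \<in> words N c" for b s t p r
    using that by blast
  \<comment> \<open>The summand 1 keeps D positive when D0 = 0.\<close>
  define D where "D = real K * (real K * D0) + 1"
  define A where "A b = x_op N a b c - complex_of_real lam \<cdot>\<^sub>m 1\<^sub>m (N ^ a * N ^ c)" for b
  let ?Q = "product_proj N a c"
  have lam: "lam > 0" using q qdim_pos[OF N] by (simp add: lam_def)
  have D: "D > 0" using D0 by (simp add: D_def add_nonneg_pos)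
  have Q: "?Q \<in> carrier_mat K K" unfolding K_def by (rule product_proj_carrier[OF N])
  have X: "x_op N a b c \<in> carrier_mat K K" for b unfolding K_def by (rule x_op_carrier[OF N])
  have A: "A b \<in> carrier_mat K K" for b using X[of b] by (auto simp: A_def K_def power_add)
  have bound: "euclid_norm (A b *\<^sub>v v) \<le> real K * (real K * (D0 * q ^ b))"
    if v: "v \<in> HH N a c" "euclid_norm v \<le> 1" for b v
  proof -
    have vc: "v \<in> carrier_vec K" and Qv: "?Q *\<^sub>v v = v"
      using HH_carrier_and_fixed[OF N v(1)] by (auto simp: K_def)
    \<comment> \<open>Entrywise, \<open>x_op\<close> is close to a multiple of P_a tensor P_c and
      not of the full identity matrix. On \<open>HH\<close> the two act alike, so the estimate is
      made for B.\<close>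
    define B where "B = x_op N a b c - complex_of_real lam \<cdot>\<^sub>m ?Q"
    have B: "B \<in> carrier_mat K K" unfolding B_def by (intro minus_carrier_mat smult_carrier_mat Q)
    have "A b *\<^sub>v v = x_op N a b c *\<^sub>v v - complex_of_real lam \<cdot>\<^sub>v v"
      unfolding A_def power_add[symmetric] K_def[symmetric]
      using minus_mult_distrib_mat_vec[OF X smult_carrier_mat[OF one_carrier_mat] vc, of b]
        smult_mat_mult_vec[OF one_carrier_mat vc] vc by simp
    also have "\<dots> = B *\<^sub>v v"
      unfolding B_def using minus_mult_distrib_mat_vec[OF X smult_carrier_mat[OF Q] vc, of b]
        smult_mat_mult_vec[OF Q vc] by (simp add: Qv)
    finally have AB: "A b *\<^sub>v v = B *\<^sub>v v" .
    show ?thesis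
      unfolding AB
    proof (rule euclid_norm_mult_le[OF B vc v(2)])
      fix i j assume "i < K" "j < K"
      then obtain x y where xy: "x \<in> words N (a + c)" "i = encode N x" "y \<in> words N (a + c)" "j = encode N y"
        unfolding K_def by (metis encodeE)
      obtain s p where sp: "x = s @ p" "s \<in> words N a" "p \<in> words N c" using words_add_split[OF xy(1)] .
      obtain t r where tr: "y = t @ r" "t \<in> words N a" "r \<in> words N c" using words_add_split[OF xy(3)] .
      have "B $$ (i, j) = x_op N a b c $$ (i, j) - complex_of_real lam * ?Q $$ (i, j)"
        using Q \<open>i < K\<close> \<open>j < K\<close> by (simp add: B_def)
      also have "\<dots> = complex_of_real (x_kernel N b c s p t r - lam * (jw N s t * jw N p r))"
        unfolding xy(2,4) sp(1) tr(1)
        using x_op_index[OF N sp(2) tr(2) sp(3) tr(3)] product_proj_index[OF N sp(2) tr(2) sp(3) tr(3)] by simp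
      finally show "cmod (B $$ (i, j)) \<le> D0 * q ^ b"
        using approx[OF sp(2) tr(2) sp(3) tr(3), of b] by (simp only: norm_of_real)
    qed
  qed
  have zero: "0\<^sub>v K \<in> HH N a c" unfolding K_def by (rule zero_in_HH[OF N])
  have nonneg: "0 \<le> op_norm_on (HH N a c) (A b)" for b
    by (rule op_norm_on_bounds(1)[OF zero A bound])
  have le: "op_norm_on (HH N a c) (A b) \<le> D * q ^ b" for b
  proof -
    have "op_norm_on (HH N a c) (A b) \<le> real K * (real K * (D0 * q ^ b))"
      by (rule op_norm_on_bounds(2)[OF zero A bound])
    also have "\<dots> \<le> D * q ^ b" using q by (simp add: D_def algebra_simps)
    finally show ?thesis .
  qed
  have inv: "x_op N a b c *\<^sub>v v \<in> HH N a c" if "v \<in> HH N a c" for b v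
  proof -
    have vc: "v \<in> carrier_vec K" using HH_carrier_and_fixed(1)[OF N that] by (simp add: K_def)
    have "x_op N a b c *\<^sub>v v = ?Q *\<^sub>v (x_op N a b c *\<^sub>v v)"
      using assoc_mult_mat_vec[OF Q X vc, of b] product_proj_x_op[OF N, of a c b] by simp
    also have "\<dots> \<in> HH N a c"
      by (rule product_proj_in_HH[OF N]) (use mult_mat_vec_carrier[OF X vc] in \<open>simp add: K_def\<close>)
    finally show ?thesis .
  qed
  have "(\<lambda>b. D * q ^ b) \<longlonglongrightarrow> 0"
    using q by (intro tendsto_mult_right_zero LIMSEQ_realpow_zero) auto
  then have lim: "(\<lambda>b. op_norm_on (HH N a c) (A b)) \<longlonglongrightarrow> 0"
    by (rule tendsto_sandwich[where f = "\<lambda>_. 0", rotated 3]) (simp_all add: nonneg le)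
  show "\<exists>lam D :: real. lam > 0 \<and> D > 0 \<and>
    (\<forall>b. (\<forall>v \<in> HH N a c. x_op N a b c *\<^sub>v v \<in> HH N a c) \<and>
      op_norm_on (HH N a c)
        (x_op N a b c - complex_of_real lam \<cdot>\<^sub>m 1\<^sub>m (N ^ a * N ^ c)) \<le> D * q ^ b) \<and>
    (\<lambda>b. op_norm_on (HH N a c)
        (x_op N a b c - complex_of_real lam \<cdot>\<^sub>m 1\<^sub>m (N ^ a * N ^ c))) \<longlonglongrightarrow> 0"
    by (intro exI[of _ lam] exI[of _ D] conjI allI ballI lam D inv le[unfolded A_def] lim[unfolded A_def])
qed

end
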